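(* Let $D$ be a division ring with center $F$ such that $D$ is finite-dimensional over $F$. Let $f(x_1,\ldots,x_n)\in F[x_1,\ldots,x_n]$ be a multilinear polynomial in noncommuting indeterminates $x_1,\dots,x_n$ such that $f$ is non-central over the matrix ring $\mathrm{M}_2(F)$. Then there exist elements $c_1,\ldots,c_n\in D$ such that the field $F(f(c_1,\ldots,c_n))$ is a maximal subfield of $D$.
   Context: $F[x_1,\dots,x_n]$ denotes the free associative $F$-algebra on the noncommuting indeterminates $x_1,\dots,x_n$. A multilinear polynomial over $F$ is an element of the form $f(x_1,\dots,x_n)=\sum_{\sigma\in S_n} a_\sigma x_{\sigma(1)}x_{\sigma(2)}\cdots x_{\sigma(n)}$ with $a_\sigma\in F$, where $S_n$ is the symmetric group on $n$ letters. It is non-central over $\mathrm{M}_2(F)$ if its set of values $f(\mathrm{M}_2(F))=\{f(T_1,\dots,T_n)\mid T_i\in \mathrm{M}_2(F)\}$ is not contained in the center of $\mathrm{M}_2(F)$ (the scalar matrices). For $a\in D$, $F(a)$ denotes the subfield of $D$ generated by $a$ over $F$. A subfield of $D$ is maximal if it is not properly contained in any other subfield of $D$ (subfields are commutative). *)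

theory Defs
  imports "HOL-Analysis.Determinants" "HOL-Library.Poly_Mapping"
begin

text \<open>
  The division ring \<open>D\<close> is a type \<open>'a :: division_ring\<close> (not assumed commutative).
  Its center is made into a type of its own, so that it can serve as the field \<open>F\<close> of
  scalars, of polynomial coefficients and of matrix entries.
\<close>

typedef (overloaded) ('a :: division_ring) center = "{z :: 'a. \<forall>x. z * x = x * z}"
  morphisms of_center Abs_center
  by (rule exI[of _ 0]) simp

setup_lifting type_definition_center

lemma commute_inverse:
  fixes z x :: "'a :: division_ring"
  assumes "z * x = x * z"
  shows "inverse z * x = x * inverse z"
proof (cases "z = 0")
  case False
  have "inverse z * x = inverse z * (x * z) * inverse z"
    using False by (simp add: mult.assoc)
  also have "\<dots> = inverse z * (z * x) * inverse z"
    by (simp add: assms)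
  also have "\<dots> = x * inverse z"
    using False by (simp flip: mult.assoc)
  finally show ?thesis .
qed simp

lemma commute_mult:
  fixes y z x :: "'a :: semigroup_mult"
  assumes "y * x = x * y" and "z * x = x * z"
  shows "y * z * x = x * (y * z)"
proof -
  have "y * z * x = y * x * z"
    by (simp only: mult.assoc assms(2))
  then show ?thesis
    by (simp only: mult.assoc assms(1))
qed

instantiation center :: (division_ring) field
begin

lift_definition zero_center :: "'a center" is 0 by simp
lift_definition one_center :: "'a center" is 1 by simp
lift_definition plus_center :: "'a center \<Rightarrow> 'a center \<Rightarrow> 'a center" is "(+)"
  by (simp add: distrib_left distrib_right)
lift_definition minus_center :: "'a center \<Rightarrow> 'a center \<Rightarrow> 'a center" is "(-)"
  by (simp add: left_diff_distrib right_diff_distrib)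
lift_definition uminus_center :: "'a center \<Rightarrow> 'a center" is uminus
  by simp
lift_definition times_center :: "'a center \<Rightarrow> 'a center \<Rightarrow> 'a center" is "(*)"
  by (rule commute_mult)
lift_definition inverse_center :: "'a center \<Rightarrow> 'a center" is inverse
  by (simp add: commute_inverse)
lift_definition divide_center :: "'a center \<Rightarrow> 'a center \<Rightarrow> 'a center" is "\<lambda>x y. x * inverse y"
  by (rule commute_mult, assumption, rule commute_inverse)

instance
proof
  fix x y z :: "'a center"
  show "x + y + z = x + (y + z)" by transfer (rule add.assoc)
  show "x + y = y + x" by transfer (rule add.commute)
  show "0 + x = x" by transfer simp
  show "- x + x = 0" by transfer simp
  show "x - y = x + - y" by transfer simp
  show "x * y * z = x * (y * z)" by transfer (rule mult.assoc)
  show "x * y = y * x" by transfer (rule spec)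
  show "1 * x = x" by transfer simp
  show "(x + y) * z = x * z + y * z" by transfer (rule distrib_right)
  show "(0 :: 'a center) \<noteq> 1" by transfer (rule zero_neq_one)
  show "x \<noteq> 0 \<Longrightarrow> inverse x * x = 1" by transfer (rule left_inverse)
  show "x div y = x * inverse y" by transfer (rule refl)
  show "inverse (0 :: 'a center) = 0" by transfer (rule inverse_zero)
qed

end

definition center_scale :: "'a center \<Rightarrow> 'a \<Rightarrow> 'a :: division_ring" where
  "center_scale z x = of_center z * x"

lemma vector_space_center_scale:
  "vector_space (center_scale :: 'a center \<Rightarrow> 'a \<Rightarrow> 'a :: division_ring)"
  unfolding center_scale_def
  by standard
    (simp_all only: distrib_left distrib_right mult.assoc mult_1_left
      plus_center.rep_eq times_center.rep_eq one_center.rep_eq)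

text \<open>
  Elements of the free associative algebra over \<open>'b\<close> on the indeterminates \<open>x\<^sub>i\<close>
  (\<open>i :: nat\<close>): finitely supported functions on words, where the list \<open>[i\<^sub>1, \<dots>, i\<^sub>k]\<close> stands for
  the monomial \<open>x\<^sub>i\<^sub>1 \<cdots> x\<^sub>i\<^sub>k\<close>.
\<close>

type_synonym 'b ncpoly = "nat list \<Rightarrow>\<^sub>0 'b"

text \<open>The word \<open>map \<sigma> [1..<Suc n]\<close> is the monomial \<open>x\<^sub>\<sigma>\<^sub>(\<^sub>1\<^sub>) \<cdots> x\<^sub>\<sigma>\<^sub>(\<^sub>n\<^sub>)\<close>.\<close>

definition multilinear_ncpoly :: "nat \<Rightarrow> 'b :: field ncpoly \<Rightarrow> bool" where
  "multilinear_ncpoly n f \<longleftrightarrow>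
     (\<exists>a. f = (\<Sum>\<sigma> | \<sigma> permutes {1..n}. Poly_Mapping.single (map \<sigma> [1..<Suc n]) (a \<sigma>)))"

text \<open>
  The value of \<open>f\<close> under \<open>x\<^sub>i \<mapsto> c i\<close> in an algebra with scalar multiplication \<open>smul\<close>,
  product \<open>mul\<close> and unit \<open>one\<close>. The operations are parameters because the matrix product
  is not the type-class product on \<open>'b ^ 2 ^ 2\<close>. Only \<open>c i\<close> with \<open>x\<^sub>i\<close> occurring in \<open>f\<close> matters.
\<close>

definition ncpoly_value ::
    "('b :: field \<Rightarrow> 'c \<Rightarrow> 'c) \<Rightarrow> ('c \<Rightarrow> 'c \<Rightarrow> 'c) \<Rightarrow> 'c \<Rightarrow> 'b ncpoly \<Rightarrow> (nat \<Rightarrow> 'c) \<Rightarrow> 'c :: ab_group_add"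
  where
  "ncpoly_value smul mul one f c =
     (\<Sum>w\<in>Poly_Mapping.keys f. smul (Poly_Mapping.lookup f w) (foldr (\<lambda>i. mul (c i)) w one))"

definition M2_value :: "'b :: field ncpoly \<Rightarrow> (nat \<Rightarrow> 'b ^ 2 ^ 2) \<Rightarrow> 'b ^ 2 ^ 2" where
  "M2_value = ncpoly_value (\<lambda>z A. mat z ** A) (**) (mat 1)"

definition division_ring_value ::
    "('a :: division_ring) center ncpoly \<Rightarrow> (nat \<Rightarrow> 'a) \<Rightarrow> 'a" where
  "division_ring_value = ncpoly_value center_scale (*) 1"

definition noncentral_over_M2 :: "'b :: field ncpoly \<Rightarrow> bool" where
  "noncentral_over_M2 f \<longleftrightarrow> \<not> range (M2_value f) \<subseteq> {A. \<forall>B. A ** B = B ** A}"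

definition comm_subfield :: "'a :: division_ring set \<Rightarrow> bool" where
  "comm_subfield K \<longleftrightarrow>
     1 \<in> K \<and> (\<forall>x\<in>K. \<forall>y\<in>K. x - y \<in> K \<and> x * y \<in> K \<and> x * y = y * x) \<and> (\<forall>x\<in>K. inverse x \<in> K)"

definition maximal_comm_subfield :: "'a :: division_ring set \<Rightarrow> bool" where
  "maximal_comm_subfield K \<longleftrightarrow> comm_subfield K \<and> \<not> (\<exists>L. comm_subfield L \<and> K \<subset> L)"

text \<open>\<open>F(a)\<close>, the smallest subfield of \<open>D\<close> containing \<open>F\<close> and \<open>a\<close>:\<close>

definition center_adjoin :: "'a :: division_ring \<Rightarrow> 'a set" where
  "center_adjoin a = comm_subfield hull (insert a (range of_center))"

text \<open>
  The hull is taken over a nonempty family: the double centralizer of \<open>F \<union> {a}\<close> is a member.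
\<close>

lemma comm_subfield_center_adjoin: "comm_subfield (center_adjoin (a :: 'a :: division_ring))"
proof -
  define C where "C S = {x :: 'a. \<forall>s\<in>S. x * s = s * x}" for S
  let ?S = "insert a (range of_center)"
  have central: "of_center z * x = x * of_center z" for z and x :: 'a
    using of_center[of z] by blast
  have "?S \<subseteq> C ?S"
    by (auto simp: C_def central)
  then have "C (C ?S) \<subseteq> C ?S"
    unfolding C_def by blast
  then have comm: "x * y = y * x" if "x \<in> C (C ?S)" "y \<in> C (C ?S)" for x y
    using that unfolding C_def by blast
  have mult: "x * y \<in> C T" if "x \<in> C T" "y \<in> C T" for x y T
    using that by (auto simp: C_def intro!: commute_mult)
  have diff: "x - y \<in> C T" if "x \<in> C T" "y \<in> C T" for x y T
    using that by (simp add: C_def left_diff_distrib right_diff_distrib)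
  have inv: "inverse x \<in> C T" if "x \<in> C T" for x T
    using that by (auto simp: C_def intro!: commute_inverse)
  have one: "1 \<in> C T" for T
    by (simp add: C_def)
  have "comm_subfield (C (C ?S))"
    unfolding comm_subfield_def by (intro conjI ballI one diff mult comm inv)
  moreover have "t \<in> C (C T)" if "t \<in> T" for t T
    unfolding C_def by (rule CollectI, rule ballI) (use that in \<open>force simp: C_def\<close>)
  then have "?S \<subseteq> C (C ?S)"
    by (rule subsetI)
  ultimately have "\<exists>K. comm_subfield K \<and> ?S \<subseteq> K"
    by blast
  then show ?thesis
    unfolding center_adjoin_def hull_def by (auto simp: comm_subfield_def)
qed

end

theory Submission
  imports Defs "HOL-Computational_Algebra.Polynomial" "HOL-Library.Multiset"
begin

text \<open>
  Let \<open>F\<close> be the center of \<open>D\<close> and \<open>L\<close> a subfield equal to its own centralizer, and consider \<open>D\<close> as a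
  right vector space over \<open>L\<close>. Left multiplications by elements of \<open>D\<close> are \<open>L\<close>-linear operators
  on it, and \<open>F(a)\<close> is a maximal subfield as soon as left multiplication by \<open>a\<close> has a cyclic vector
  \<open>v\<close>, that is, the elements \<open>a ^ k * v\<close> span \<open>D\<close> over \<open>L\<close>: then everything commuting with \<open>a\<close> is a
  polynomial in \<open>a\<close> with coefficients in \<open>F\<close> (\<open>cyclic_vector_imp_maximal\<close>). So an element
  \<open>f(c)\<close> with a cyclic vector has to be found.

  If \<open>D\<close> is commutative, there is nothing to show. Otherwise \<open>F\<close> is infinite, by Wedderburn's theorem
  on finite division rings, and the values of \<open>f\<close> can be studied in the larger algebra of
  \<open>L\<close>-linear operators on \<open>D\<close>. There a value with a cyclic vector is easy to exhibit: since \<open>f\<close> is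
  non-central on two by two matrices over \<open>F\<close>, it takes a value with zero diagonal and two nonzero
  off-diagonal entries there (\<open>noncentral_generic_value\<close>). The square of such a matrix is scalar, and
  copies of it, scaled so that their squares are distinct scalars, are placed along the diagonal
  of an operator, with a zero entry left over in odd dimension (\<open>ex_cyclic_operator_value\<close>).

  By Jacobson density (\<open>interpolation\<close>) the arguments of this value are sums of two-sided
  multiplications \<open>x \<mapsto> d * x * l\<close> with \<open>l \<in> L\<close>. As \<open>f\<close> is multilinear, its value depends in an
  affine way on each single right factor \<open>l\<close>, and having \<open>v\<close> as a cyclic vector is an open condition
  (\<open>cyclic_vector_open\<close>). As \<open>F\<close> is infinite, the right factors can therefore be
  moved into \<open>F\<close> one after the other (\<open>replace_operator\<close>), which turns the arguments into left
  multiplications by elements of \<open>D\<close>.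

  Wedderburn's theorem is obtained from the same tools: counting the two-sided multiplications in two
  ways shows that all self-centralizing subfields of a finite division ring have the same
  cardinality (\<open>self_centralizing_card_eq\<close>), from which it follows that every element is
  conjugate into any given one of them.
\<close>

section \<open>Centralizers and self-centralizing subfields\<close>

definition centralizer :: "'a :: division_ring set \<Rightarrow> 'a set" where
  "centralizer S = {x. \<forall>s\<in>S. x * s = s * x}"

lemma centralizerD: "x \<in> centralizer S \<Longrightarrow> s \<in> S \<Longrightarrow> x * s = s * x"
  by (simp add: centralizer_def)

lemma of_center_commute: "of_center z * x = x * of_center z"
  using of_center[of z] by blast

lemma of_center_in_centralizer [simp]: "of_center z \<in> centralizer S"
  by (simp add: centralizer_def of_center_commute)

lemma zero_in_centralizer [simp]: "0 \<in> centralizer S"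
  and one_in_centralizer [simp]: "1 \<in> centralizer S"
  by (simp_all add: centralizer_def)

lemma centralizer_add: "x \<in> centralizer S \<Longrightarrow> y \<in> centralizer S \<Longrightarrow> x + y \<in> centralizer S"
  and centralizer_diff: "x \<in> centralizer S \<Longrightarrow> y \<in> centralizer S \<Longrightarrow> x - y \<in> centralizer S"
  and centralizer_uminus: "x \<in> centralizer S \<Longrightarrow> - x \<in> centralizer S"
  by (simp_all add: centralizer_def distrib_left distrib_right left_diff_distrib right_diff_distrib)

lemma centralizer_mult: "x \<in> centralizer S \<Longrightarrow> y \<in> centralizer S \<Longrightarrow> x * y \<in> centralizer S"
  by (auto simp: centralizer_def intro!: commute_mult)

lemma centralizer_inverse: "x \<in> centralizer S \<Longrightarrow> inverse x \<in> centralizer S"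
  by (auto simp: centralizer_def intro!: commute_inverse)

lemma centralizer_power: "x \<in> centralizer S \<Longrightarrow> x ^ k \<in> centralizer S"
  by (induction k) (auto simp: centralizer_mult)

lemmas centralizer_closed = centralizer_add centralizer_diff centralizer_uminus centralizer_mult
  centralizer_inverse centralizer_power

lemma centralizer_UNIV: "x \<in> centralizer UNIV \<longleftrightarrow> x \<in> range of_center"
proof
  assume "x \<in> centralizer UNIV"
  then have "x = of_center (Abs_center x)"
    by (simp add: centralizer_def Abs_center_inverse)
  then show "x \<in> range of_center" by blast
qed auto

text \<open>Maximal commuting sets exist by Zorn's lemma, and such a set is its own centralizer:
  any element commuting with all of it could be added to it.\<close>

lemma ex_self_centralizing:
  fixes S :: "'a :: division_ring set"
  assumes "S \<subseteq> centralizer S"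
  shows "\<exists>L. S \<subseteq> L \<and> centralizer L = L"
proof -
  let ?A = "{L. S \<subseteq> L \<and> L \<subseteq> centralizer L}"
  have "\<exists>M\<in>?A. \<forall>X\<in>?A. M \<subseteq> X \<longrightarrow> X = M"
  proof (rule subset_Zorn_nonempty)
    show "?A \<noteq> {}" using assms by blast
  next
    fix C assume "C \<noteq> {}" and "subset.chain ?A C"
    then have sub: "\<And>X. X \<in> C \<Longrightarrow> S \<subseteq> X \<and> X \<subseteq> centralizer X"
      and lin: "\<And>X Y. X \<in> C \<Longrightarrow> Y \<in> C \<Longrightarrow> X \<subseteq> Y \<or> Y \<subseteq> X"
      by (auto simp: subset_chain_def)
    have "x * y = y * x" if xy: "x \<in> \<Union>C" "y \<in> \<Union>C" for x y
    proof -
      obtain X Y where XY: "X \<in> C" "Y \<in> C" "x \<in> X" "y \<in> Y" using xy by blast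
      from lin[OF XY(1,2)] obtain Z where "Z \<in> C" "x \<in> Z" "y \<in> Z" using XY by blast
      then show ?thesis using sub[of Z] centralizerD by blast
    qed
    then have "\<Union>C \<subseteq> centralizer (\<Union>C)" unfolding centralizer_def by blast
    moreover have "S \<subseteq> \<Union>C"
    proof -
      obtain X where "X \<in> C" using \<open>C \<noteq> {}\<close> by blast
      then have "S \<subseteq> X" using sub by blast
      also have "X \<subseteq> \<Union>C" using \<open>X \<in> C\<close> by (rule Union_upper)
      finally show ?thesis .
    qed
    ultimately show "\<Union>C \<in> ?A" by simp
  qed
  then obtain M where M: "M \<in> ?A" and max: "\<forall>X\<in>?A. M \<subseteq> X \<longrightarrow> X = M" ..
  have "x \<in> M" if "x \<in> centralizer M" for x
  proof -
    have "insert x M \<subseteq> centralizer (insert x M)"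
      using that M unfolding centralizer_def by auto
    then have "insert x M \<in> ?A" using M by auto
    then have "insert x M = M" using max by (simp add: subset_insertI)
    then show ?thesis by blast
  qed
  then have "centralizer M = M" using M by blast
  then show ?thesis using M by blast
qed

section \<open>Two-sided multiplications\<close>

interpretation D: vector_space "center_scale :: 'a center \<Rightarrow> 'a \<Rightarrow> 'a :: division_ring"
  by (rule vector_space_center_scale)

text \<open>The injectivity part of the theorem of Artin and Whaples on elements \<open>a \<otimes> g\<close> acting on \<open>D\<close> by
  \<open>x \<mapsto> a x g\<close>. Evaluating at \<open>x y\<close>, and at \<open>x\<close> followed by right multiplication by \<open>y\<close>, gives the same
  left-hand side. Unless all coefficients \<open>g a\<close> are central, the difference of the right-hand
  sides is a relation of the same kind for some \<open>a \<in> A\<close> in terms of the others; so \<open>a\<close> lies in their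
  span and can be eliminated.\<close>

lemma two_sided_dependence:
  fixes b :: "'a :: division_ring"
  assumes "finite A" and "\<And>x. b * x = (\<Sum>a\<in>A. a * x * g a)"
  shows "b \<in> D.span A"
  using assms
proof (induction "card A" arbitrary: A b g rule: less_induct)
  case less
  note fin = \<open>finite A\<close> and eq = less.prems(2)
  show ?case
  proof (cases "\<forall>a\<in>A. g a \<in> centralizer UNIV")
    case True
    have "b = (\<Sum>a\<in>A. a * g a)" using eq[of 1] by simp
    also have "\<dots> \<in> D.span A"
    proof (rule D.span_sum)
      fix a assume a: "a \<in> A"
      then obtain z where "g a = of_center z" using True by (auto simp: centralizer_UNIV)
      then have "a * g a = center_scale z a" by (simp add: center_scale_def of_center_commute)
      then show "a * g a \<in> D.span A" using a by (simp add: D.span_base D.span_scale)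
    qed
    finally show ?thesis .
  next
    case False
    then obtain a0 y where a0: "a0 \<in> A" and "y * g a0 - g a0 * y \<noteq> 0"
      by (auto simp: centralizer_def) metis
    define c where "c a = y * g a - g a * y" for a
    have c0: "c a0 \<noteq> 0" using \<open>y * g a0 - g a0 * y \<noteq> 0\<close> by (simp add: c_def)
    let ?A = "A - {a0}"
    have A: "A = insert a0 ?A" "finite ?A" "card ?A < card A"
      using a0 fin card_Diff1_less by (auto simp del: card_Diff_insert)
    have split: "(\<Sum>a\<in>A. h a) = h a0 + (\<Sum>a\<in>?A. h a)" for h :: "'a \<Rightarrow> 'a"
      by (rule sum.remove[OF fin a0])
    have zero: "(\<Sum>a\<in>A. a * x * c a) = 0" for x
    proof -
      have "(\<Sum>a\<in>A. a * x * c a) = (\<Sum>a\<in>A. a * (x * y) * g a) - (\<Sum>a\<in>A. a * x * g a) * y"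
        unfolding c_def sum_distrib_right sum_subtractf[symmetric]
        by (simp add: right_diff_distrib mult.assoc)
      also have "\<dots> = b * (x * y) - b * x * y" by (simp only: eq)
      finally show ?thesis by (simp add: mult.assoc)
    qed
    have z: "a0 * x * c a0 + (\<Sum>a\<in>?A. a * x * c a) = 0" for x
      using zero[of x] unfolding split .
    have "a0 * x = (\<Sum>a\<in>?A. a * x * (- c a * inverse (c a0)))" for x
    proof -
      have "a0 * x = a0 * x * c a0 * inverse (c a0)" using c0 by (simp add: mult.assoc)
      also have "a0 * x * c a0 = - (\<Sum>a\<in>?A. a * x * c a)" using z[of x] by (simp add: eq_neg_iff_add_eq_0)
      finally show ?thesis
        by (simp add: sum_distrib_right sum_negf[symmetric] mult.assoc)
    qed
    then have in_span: "a0 \<in> D.span ?A" by (rule less.hyps[OF A(3,2)])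
    then obtain z where z: "a0 = (\<Sum>a\<in>?A. center_scale (z a) a)"
      using D.span_finite[OF A(2)] by auto
    have "b * x = (\<Sum>a\<in>?A. a * x * (g a + of_center (z a) * g a0))" for x
    proof -
      have "a0 * x * g a0 = (\<Sum>a\<in>?A. a * x * (of_center (z a) * g a0))"
        by (subst z) (simp add: center_scale_def sum_distrib_right of_center_commute mult.assoc)
      then show ?thesis unfolding eq split
        by (simp only: distrib_left sum.distrib add.commute)
    qed
    then have "b \<in> D.span ?A" by (rule less.hyps[OF A(3,2)])
    then show ?thesis using D.span_mono[of ?A A] by blast
  qed
qed

inductive_set bimult :: "'a :: division_ring set \<Rightarrow> ('a \<Rightarrow> 'a) set" for L where
  mult: "l \<in> L \<Longrightarrow> (\<lambda>x. d * x * l) \<in> bimult L"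
| add: "\<phi> \<in> bimult L \<Longrightarrow> \<psi> \<in> bimult L \<Longrightarrow> (\<lambda>x. \<phi> x + \<psi> x) \<in> bimult L"

lemma bimult_mult_left: "\<phi> \<in> bimult L \<Longrightarrow> (\<lambda>x. d * \<phi> x) \<in> bimult L"
proof (induction rule: bimult.induct)
  case (mult l c)
  then show ?case using bimult.mult[of l L "d * c"] by (simp add: mult.assoc)
next
  case (add \<phi> \<psi>)
  then show ?case using bimult.add[OF add.IH] by (simp add: distrib_left)
qed

lemma bimult_mult_right:
  assumes "centralizer L = L" "l \<in> L"
  shows "\<phi> \<in> bimult L \<Longrightarrow> (\<lambda>x. \<phi> x * l) \<in> bimult L"
proof (induction rule: bimult.induct)
  case (mult k c)
  have "k * l \<in> L" using centralizer_mult[of k L l] mult assms(2) unfolding assms(1) by blast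
  then have "(\<lambda>x. c * x * (k * l)) \<in> bimult L" by (rule bimult.mult)
  then show ?case by (simp add: mult.assoc)
next
  case (add \<phi> \<psi>)
  then show ?case using bimult.add[OF add.IH] by (simp add: distrib_right)
qed

lemma bimult_additive: "\<phi> \<in> bimult L \<Longrightarrow> \<phi> (x + y) = \<phi> x + \<phi> y"
  by (induction rule: bimult.induct) (auto simp: algebra_simps)

lemma bimult_zero: "\<phi> \<in> bimult L \<Longrightarrow> \<phi> 0 = 0"
  by (drule bimult_additive[of \<phi> L 0 0]) simp

lemma bimult_diff: "\<phi> \<in> bimult L \<Longrightarrow> \<phi> (x - y) = \<phi> x - \<phi> y"
  by (drule bimult_additive[of \<phi> L "x - y" y]) (simp add: eq_diff_eq)

lemma bimult_sum:
  assumes "\<phi> \<in> bimult L"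
  shows "\<phi> (sum g I) = (\<Sum>i\<in>I. \<phi> (g i))"
  by (induction I rule: infinite_finite_induct)
    (simp_all add: bimult_zero[OF assms] bimult_additive[OF assms])

lemma bimult_linear:
  assumes "centralizer L = L" "l \<in> L"
  shows "\<phi> \<in> bimult L \<Longrightarrow> \<phi> (x * l) = \<phi> x * l"
proof (induction rule: bimult.induct)
  case (mult k c)
  then have "k * l = l * k" using assms centralizerD by blast
  then show ?case by (simp add: mult.assoc)
qed (simp add: distrib_right)

lemma bimult_id:
  assumes "centralizer L = L"
  shows "(\<lambda>x. x) \<in> bimult L"
proof -
  have "1 \<in> L" using one_in_centralizer[of L] unfolding assms .
  then have "(\<lambda>x. 1 * x * 1) \<in> bimult L" by (rule bimult.mult)
  then show ?thesis by simp
qed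

lemma bimult_sumI:
  assumes "centralizer L = L" "\<And>i. i \<in> I \<Longrightarrow> \<phi> i \<in> bimult L"
  shows "(\<lambda>x. \<Sum>i\<in>I. \<phi> i x) \<in> bimult L"
  using assms(2)
proof (induction I rule: infinite_finite_induct)
  case (insert i I)
  then show ?case using bimult.add[of "\<phi> i" L "\<lambda>x. \<Sum>i\<in>I. \<phi> i x"] by simp
qed (use bimult_mult_left[OF bimult_id[OF assms(1)], of 0] in simp_all)

text \<open>Jacobson density for \<open>D\<close> as a module over its two-sided multiplications; the endomorphisms of
  this module are the right multiplications by \<open>L\<close>. Suppose that what kills \<open>B\<close> and \<open>w\<close> also
  kills \<open>x\<close>. If an operator \<open>e\<close> kills \<open>B\<close> and maps \<open>w\<close>
  to \<open>1\<close>, then every \<open>\<psi>\<close> killing \<open>B\<close> satisfies \<open>\<psi> x = \<psi> w * e x\<close>, as \<open>\<psi> - \<psi> w * e\<close> kills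
  \<open>B\<close> and \<open>w\<close>; comparing this for \<open>e\<close> followed by right multiplications
  shows that \<open>e x\<close> centralizes \<open>L\<close>.\<close>

lemma density:
  fixes L :: "'a :: division_ring set"
  assumes L: "centralizer L = L" and "finite B"
    and "\<And>\<phi>. \<phi> \<in> bimult L \<Longrightarrow> (\<And>b. b \<in> B \<Longrightarrow> \<phi> b = 0) \<Longrightarrow> \<phi> x = 0"
  shows "\<exists>g. (\<forall>b\<in>B. g b \<in> L) \<and> x = (\<Sum>b\<in>B. b * g b)"
  using assms(2,3)
proof (induction B arbitrary: x rule: finite_induct)
  case empty
  have "x = 0" by (rule empty[OF bimult_id[OF L]]) simp
  then show ?case by simp
next
  case (insert w B)
  show ?case
  proof (cases "\<forall>\<phi>\<in>bimult L. (\<forall>b\<in>B. \<phi> b = 0) \<longrightarrow> \<phi> w = 0")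
    case True
    have "\<exists>g. (\<forall>b\<in>B. g b \<in> L) \<and> x = (\<Sum>b\<in>B. b * g b)"
    proof (rule insert.IH)
      fix \<phi> assume \<phi>: "\<phi> \<in> bimult L" "\<And>b. b \<in> B \<Longrightarrow> \<phi> b = 0"
      then have "\<phi> w = 0" using True by blast
      show "\<phi> x = 0"
        by (rule insert.prems[OF \<phi>(1)]) (use \<phi>(2) \<open>\<phi> w = 0\<close> in blast)
    qed
    then obtain g where g: "\<forall>b\<in>B. g b \<in> L" "x = (\<Sum>b\<in>B. b * g b)" by blast
    let ?g = "g(w := 0)"
    have "(\<Sum>b\<in>B. b * ?g b) = (\<Sum>b\<in>B. b * g b)"
      using insert.hyps by (intro sum.cong) auto
    then have "(\<forall>b\<in>insert w B. ?g b \<in> L) \<and> x = (\<Sum>b\<in>insert w B. b * ?g b)"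
      using g insert.hyps zero_in_centralizer[of L] L by auto
    then show ?thesis by (intro exI[of _ ?g])
  next
    case False
    then obtain \<phi> where \<phi>: "\<phi> \<in> bimult L" "\<forall>b\<in>B. \<phi> b = 0" "\<phi> w \<noteq> 0" by blast
    define e where "e y = inverse (\<phi> w) * \<phi> y" for y
    have e: "e \<in> bimult L" "\<forall>b\<in>B. e b = 0" "e w = 1"
      using \<phi> bimult_mult_left[of \<phi> L "inverse (\<phi> w)"] by (simp_all add: e_def[abs_def])
    have key: "\<psi> x = \<psi> w * e x" if \<psi>: "\<psi> \<in> bimult L" "\<forall>b\<in>B. \<psi> b = 0" for \<psi>
    proof -
      have "(\<lambda>y. \<psi> y + - \<psi> w * e y) \<in> bimult L"
        by (rule bimult.add[OF \<psi>(1) bimult_mult_left[OF e(1)]])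
      then have "\<psi> x + - \<psi> w * e x = 0"
      proof (rule insert.prems)
        fix b assume "b \<in> insert w B"
        then show "\<psi> b + - \<psi> w * e b = 0"
          by (elim insertE) (simp_all add: e(3) bspec[OF e(2)] bspec[OF \<psi>(2)])
      qed
      then show ?thesis by simp
    qed
    have "e x \<in> centralizer L"
      unfolding centralizer_def
    proof (intro CollectI ballI)
      fix l assume "l \<in> L"
      have "e x * l = e w * l * e x"
        by (rule key[OF bimult_mult_right[OF L \<open>l \<in> L\<close> e(1)]]) (simp add: bspec[OF e(2)])
      then show "e x * l = l * e x" by (simp add: e(3))
    qed
    then have t: "e x \<in> L" using L by simp
    have "\<exists>g. (\<forall>b\<in>B. g b \<in> L) \<and> x - w * e x = (\<Sum>b\<in>B. b * g b)"
    proof (rule insert.IH)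
      fix \<psi> assume \<psi>: "\<psi> \<in> bimult L" "\<And>b. b \<in> B \<Longrightarrow> \<psi> b = 0"
      have "\<psi> x = \<psi> w * e x" by (rule key) (use \<psi> in blast)+
      then show "\<psi> (x - w * e x) = 0"
        by (simp add: bimult_diff[OF \<psi>(1)] bimult_linear[OF L t \<psi>(1)])
    qed
    then obtain g where g: "\<forall>b\<in>B. g b \<in> L" "x - w * e x = (\<Sum>b\<in>B. b * g b)" by blast
    let ?g = "g(w := e x)"
    have "(\<Sum>b\<in>B. b * ?g b) = (\<Sum>b\<in>B. b * g b)"
      using insert.hyps by (intro sum.cong) auto
    then have "(\<forall>b\<in>insert w B. ?g b \<in> L) \<and> x = (\<Sum>b\<in>insert w B. b * ?g b)"
      using g t insert.hyps by (auto simp: algebra_simps)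
    then show ?thesis by (intro exI[of _ ?g])
  qed
qed

section \<open>Right independence and interpolation\<close>

definition right_independent :: "'a :: division_ring set \<Rightarrow> 'a set \<Rightarrow> bool" where
  "right_independent L B \<longleftrightarrow>
     (\<forall>b\<in>B. \<not> (\<exists>g. (\<forall>c\<in>B - {b}. g c \<in> L) \<and> b = (\<Sum>c\<in>B - {b}. c * g c)))"

text \<open>Density in its usual form: an operator separating each \<open>b \<in> B\<close> from the others can be rescaled
  on the left to take any value at \<open>b\<close>.\<close>

lemma interpolation:
  fixes L :: "'a :: division_ring set"
  assumes L: "centralizer L = L" and fin: "finite B" and ind: "right_independent L B"
  shows "\<exists>\<phi>\<in>bimult L. \<forall>b\<in>B. \<phi> b = h b"
proof -
  have "\<exists>\<phi>\<in>bimult L. (\<forall>c\<in>B - {b}. \<phi> c = 0) \<and> \<phi> b \<noteq> 0" if "b \<in> B" for b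
  proof (rule ccontr)
    assume no: "\<not> ?thesis"
    have "\<exists>g. (\<forall>c\<in>B - {b}. g c \<in> L) \<and> b = (\<Sum>c\<in>B - {b}. c * g c)"
    proof (rule density[OF L])
      fix \<phi> assume "\<phi> \<in> bimult L" "\<And>c. c \<in> B - {b} \<Longrightarrow> \<phi> c = 0"
      then show "\<phi> b = 0" using no by blast
    qed (use fin in simp)
    then show False using ind that unfolding right_independent_def by blast
  qed
  then obtain F where F: "\<And>b. b \<in> B \<Longrightarrow> F b \<in> bimult L"
    and F0: "\<And>b c. b \<in> B \<Longrightarrow> c \<in> B - {b} \<Longrightarrow> F b c = 0"
    and F1: "\<And>b. b \<in> B \<Longrightarrow> F b b \<noteq> 0" by metis
  define \<phi> where "\<phi> x = (\<Sum>b\<in>B. h b * inverse (F b b) * F b x)" for x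
  have "\<phi> \<in> bimult L" unfolding \<phi>_def[abs_def]
    by (rule bimult_sumI[OF L]) (rule bimult_mult_left[OF F])
  moreover have "\<phi> c = h c" if c: "c \<in> B" for c
  proof -
    have "\<phi> c = h c * inverse (F c c) * F c c + (\<Sum>b\<in>B - {c}. h b * inverse (F b b) * F b c)"
      unfolding \<phi>_def by (rule sum.remove[OF fin c])
    also have "(\<Sum>b\<in>B - {c}. h b * inverse (F b b) * F b c) = 0"
    proof (rule sum.neutral, rule ballI)
      fix b assume "b \<in> B - {c}"
      then have "F b c = 0" using F0[of b c] c by auto
      then show "h b * inverse (F b b) * F b c = 0" by simp
    qed
    finally show ?thesis using F1[OF c] by (simp add: mult.assoc)
  qed
  ultimately show ?thesis by blast
qed

section \<open>Cardinality of self-centralizing subfields\<close>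

text \<open>A right basis over \<open>K\<close>, in the form needed for counting. A spanning set of least cardinality is
  one: being a centralizer, \<open>K\<close> contains inverses, so that a nontrivial relation could be
  solved for one of its elements.\<close>

lemma ex_right_basis:
  fixes S :: "'a :: division_ring set"
  assumes fin: "finite (UNIV :: 'a set)" and K: "K = centralizer S"
  shows "\<exists>B. finite B \<and> bij_betw (\<lambda>g. \<Sum>b\<in>B. b * g b) (B \<rightarrow>\<^sub>E K) (UNIV :: 'a set)"
proof -
  define P where "P B \<longleftrightarrow> (\<forall>x. \<exists>g. (\<forall>b\<in>B. g b \<in> K) \<and> x = (\<Sum>b\<in>B. b * g b))" for B :: "'a set"
  have "P UNIV" unfolding P_def
  proof
    fix x :: 'a
    let ?g = "\<lambda>b. if b = x then 1 else 0 :: 'a"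
    have "(\<Sum>b\<in>UNIV. b * ?g b) = (\<Sum>b\<in>UNIV. if b = x then x else 0)"
      by (rule sum.cong) auto
    then have "(\<forall>b\<in>UNIV. ?g b \<in> K) \<and> x = (\<Sum>b\<in>UNIV. b * ?g b)"
      using fin by (simp add: K)
    then show "\<exists>g. (\<forall>b\<in>UNIV. g b \<in> K) \<and> x = (\<Sum>b\<in>UNIV. b * g b)" by (intro exI[of _ ?g])
  qed
  then obtain B where B: "P B" and min: "\<And>C. P C \<Longrightarrow> card B \<le> card C"
    using ex_has_least_nat[of P UNIV card] by blast
  have finB: "finite B" by (rule finite_subset[OF subset_UNIV fin])
  have "inj_on (\<lambda>g. \<Sum>b\<in>B. b * g b) (B \<rightarrow>\<^sub>E K)"
  proof (rule inj_onI, rule ccontr)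
    fix g g' assume g: "g \<in> B \<rightarrow>\<^sub>E K" "g' \<in> B \<rightarrow>\<^sub>E K" "g \<noteq> g'"
      and eq: "(\<Sum>b\<in>B. b * g b) = (\<Sum>b\<in>B. b * g' b)"
    then obtain b0 where b0: "b0 \<in> B" "g b0 \<noteq> g' b0" using PiE_ext[of g B "\<lambda>_. K" g'] by blast
    define c where "c b = g b - g' b" for b
    have cK: "c b \<in> K" if "b \<in> B" for b
      using g that by (auto simp: c_def K intro: centralizer_diff)
    have c0: "c b0 \<noteq> 0" using b0 by (simp add: c_def)
    let ?B = "B - {b0}"
    have "(\<Sum>b\<in>B. b * c b) = 0"
      using eq by (simp add: c_def right_diff_distrib sum_subtractf)
    then have "b0 * c b0 = - (\<Sum>b\<in>?B. b * c b)"
      by (simp add: sum.remove[OF finB b0(1)] eq_neg_iff_add_eq_0)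
    then have b0_eq: "b0 = (\<Sum>b\<in>?B. b * (- c b * inverse (c b0)))"
    proof -
      have "b0 = b0 * c b0 * inverse (c b0)" using c0 by (simp add: mult.assoc)
      also have "b0 * c b0 = - (\<Sum>b\<in>?B. b * c b)" by fact
      finally show ?thesis by (simp add: sum_distrib_right sum_negf[symmetric] mult.assoc)
    qed
    have "P ?B" unfolding P_def
    proof
      fix x
      obtain h where h: "\<forall>b\<in>B. h b \<in> K" "x = (\<Sum>b\<in>B. b * h b)" using B unfolding P_def by blast
      let ?h = "\<lambda>b. h b + - c b * inverse (c b0) * h b0"
      have "x = b0 * h b0 + (\<Sum>b\<in>?B. b * h b)" using h(2) sum.remove[OF finB b0(1)] by simp
      also have "b0 * h b0 = (\<Sum>b\<in>?B. b * (- c b * inverse (c b0))) * h b0" using b0_eq by simp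
      finally have "x = (\<Sum>b\<in>?B. b * ?h b)"
        by (simp only: sum_distrib_right distrib_left sum.distrib mult.assoc add.commute)
      moreover have "\<forall>b\<in>?B. ?h b \<in> K"
        using h(1) cK b0(1) unfolding K by (intro ballI centralizer_closed) auto
      ultimately show "\<exists>g. (\<forall>b\<in>?B. g b \<in> K) \<and> x = (\<Sum>b\<in>?B. b * g b)" by (intro exI[of _ ?h]) simp
    qed
    then have "card B \<le> card ?B" by (rule min)
    then show False using card_Diff1_less[OF finB b0(1)] by simp
  qed
  moreover have "(\<lambda>g. \<Sum>b\<in>B. b * g b) ` (B \<rightarrow>\<^sub>E K) = UNIV"
  proof (rule UNIV_eq_I[symmetric])
    fix x
    obtain h where h: "\<forall>b\<in>B. h b \<in> K" "x = (\<Sum>b\<in>B. b * h b)" using B unfolding P_def by blast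
    then have "x = (\<Sum>b\<in>B. b * restrict h B b)" by simp
    moreover have "restrict h B \<in> B \<rightarrow>\<^sub>E K" using h by auto
    ultimately show "x \<in> (\<lambda>g. \<Sum>b\<in>B. b * g b) ` (B \<rightarrow>\<^sub>E K)" by (rule image_eqI)
  qed
  ultimately show ?thesis using finB unfolding bij_betw_def by blast
qed

lemma right_basis_unique:
  assumes "bij_betw (\<lambda>g. \<Sum>b\<in>B. b * g b) (B \<rightarrow>\<^sub>E K) (UNIV :: 'a :: division_ring set)"
    and "\<And>b. b \<in> B \<Longrightarrow> g b \<in> K" "\<And>b. b \<in> B \<Longrightarrow> h b \<in> K"
    and "(\<Sum>b\<in>B. b * g b) = (\<Sum>b\<in>B. b * h b)" and "b \<in> B"
  shows "g b = h b"
proof -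
  have "restrict g B = restrict h B"
  proof (rule inj_onD[OF bij_betw_imp_inj_on[OF assms(1)]])
    show "(\<Sum>b\<in>B. b * restrict g B b) = (\<Sum>b\<in>B. b * restrict h B b)" using assms(4) by simp
  qed (use assms(2,3) in auto)
  then show ?thesis using assms(5) by (metis restrict_apply')
qed

lemma right_basis_independent:
  assumes bij: "bij_betw (\<lambda>g. \<Sum>b\<in>B. b * g b) (B \<rightarrow>\<^sub>E K) (UNIV :: 'a :: division_ring set)"
    and fin: "finite B" and K: "K = centralizer S"
  shows "right_independent K B"
  unfolding right_independent_def
proof (intro ballI notI, elim exE conjE)
  fix b g assume b: "b \<in> B" and g: "\<forall>c\<in>B - {b}. g c \<in> K" "b = (\<Sum>c\<in>B - {b}. c * g c)"
  define g1 where "g1 c = (if c = b then 0 else g c)" for c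
  define g2 where "g2 c = (if c = b then 1 else 0 :: 'a)" for c
  have "(\<Sum>c\<in>B - {b}. c * g1 c) = b" using g(2) by (simp add: g1_def)
  moreover have "(\<Sum>c\<in>B - {b}. c * g2 c) = 0" by (rule sum.neutral) (simp add: g2_def)
  ultimately have "(\<Sum>c\<in>B. c * g1 c) = (\<Sum>c\<in>B. c * g2 c)"
    by (simp add: sum.remove[OF fin b] g1_def g2_def)
  then have "g1 b = g2 b"
    by (rule right_basis_unique[OF bij, rotated 2]) (use g(1) b in \<open>auto simp: g1_def g2_def K\<close>)
  then show False by (simp add: g1_def g2_def)
qed

text \<open>The algebra of two-sided multiplications is counted twice. By density its elements correspond to
  arbitrary functions on a basis with \<open>r\<close> elements over \<open>L\<close>; by \<open>two_sided_dependence\<close> they have unique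
  coefficients in \<open>L\<close> with respect to a basis with \<open>N\<close> elements over the center. Hence
  \<open>N = r\<^sup>2\<close>, so \<open>r\<close> does not depend on \<open>L\<close>, and neither does \<open>card L\<close>, whose \<open>r\<close>-th power is \<open>card D\<close>.\<close>

lemma self_centralizing_card_eq:
  fixes L M :: "'a :: division_ring set"
  assumes fin: "finite (UNIV :: 'a set)" and L: "centralizer L = L" and M: "centralizer M = M"
  shows "card L = card M"
proof -
  define Z where "Z = centralizer (UNIV :: 'a set)"
  have "\<exists>A. finite A \<and> bij_betw (\<lambda>g. \<Sum>b\<in>A. b * g b) (A \<rightarrow>\<^sub>E Z) (UNIV :: 'a set)"
    by (rule ex_right_basis[OF fin Z_def])
  then obtain A where finA: "finite A"
    and A: "bij_betw (\<lambda>g. \<Sum>b\<in>A. b * g b) (A \<rightarrow>\<^sub>E Z) (UNIV :: 'a set)" by blast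
  have main: "\<exists>r>0. card A = r * r \<and> card L ^ r = card (UNIV :: 'a set)"
    if L: "centralizer L = L" for L :: "'a set"
  proof -
    have "\<exists>B. finite B \<and> bij_betw (\<lambda>g. \<Sum>b\<in>B. b * g b) (B \<rightarrow>\<^sub>E L) (UNIV :: 'a set)"
      by (rule ex_right_basis[OF fin L[symmetric]])
    then obtain B where finB: "finite B"
      and B: "bij_betw (\<lambda>g. \<Sum>b\<in>B. b * g b) (B \<rightarrow>\<^sub>E L) (UNIV :: 'a set)" by blast
    have ZL: "Z \<subseteq> L" using L by (auto simp: Z_def centralizer_def)
    have zL: "z * l \<in> L" if "z \<in> L" "l \<in> L" for z l
      using centralizer_mult[of z L l] L that by simp
    have sL: "k + l \<in> L" if "k \<in> L" "l \<in> L" for k l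
      using centralizer_add[of k L l] L that by simp
    have card_D: "card L ^ card B = card (UNIV :: 'a set)"
      using bij_betw_same_card[OF B] finB by (simp add: card_funcsetE)
    have "bij_betw (\<lambda>\<phi>. restrict \<phi> B) (bimult L) (B \<rightarrow>\<^sub>E UNIV)"
      unfolding bij_betw_def
    proof
      show "inj_on (\<lambda>\<phi>. restrict \<phi> B) (bimult L)"
      proof (rule inj_onI, rule ext)
        fix \<phi> \<psi> x assume \<phi>: "\<phi> \<in> bimult L" and \<psi>: "\<psi> \<in> bimult L"
          and eq: "restrict \<phi> B = restrict \<psi> B"
        have "x \<in> (\<lambda>g. \<Sum>b\<in>B. b * g b) ` (B \<rightarrow>\<^sub>E L)" using B by (simp add: bij_betw_def)
        then obtain g where g: "g \<in> B \<rightarrow>\<^sub>E L" and x: "x = (\<Sum>b\<in>B. b * g b)" by blast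
        have lin: "\<theta> x = (\<Sum>b\<in>B. \<theta> b * g b)" if \<theta>: "\<theta> \<in> bimult L" for \<theta>
          unfolding x bimult_sum[OF \<theta>]
          by (rule sum.cong[OF refl]) (use g in \<open>auto intro!: bimult_linear[OF L _ \<theta>]\<close>)
        have "\<phi> b = \<psi> b" if "b \<in> B" for b using fun_cong[OF eq, of b] that by simp
        then show "\<phi> x = \<psi> x" by (simp add: lin[OF \<phi>] lin[OF \<psi>])
      qed
      show "(\<lambda>\<phi>. restrict \<phi> B) ` bimult L = B \<rightarrow>\<^sub>E UNIV"
      proof
        show "B \<rightarrow>\<^sub>E UNIV \<subseteq> (\<lambda>\<phi>. restrict \<phi> B) ` bimult L"
        proof
          fix h :: "'a \<Rightarrow> 'a" assume h: "h \<in> B \<rightarrow>\<^sub>E UNIV"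
          obtain \<phi> where \<phi>: "\<phi> \<in> bimult L" "\<forall>b\<in>B. \<phi> b = h b"
            using interpolation[OF L finB right_basis_independent[OF B finB L[symmetric]], of h] by blast
          have "h = restrict \<phi> B"
            using \<phi>(2) PiE_arb[OF h] by (auto simp: restrict_def fun_eq_iff)
          then show "h \<in> (\<lambda>\<phi>. restrict \<phi> B) ` bimult L" using \<phi>(1) by blast
        qed
      qed auto
    qed
    then have c1: "card (bimult L) = card (UNIV :: 'a set) ^ card B"
      using finB by (simp add: bij_betw_same_card card_funcsetE)
    have "bij_betw (\<lambda>g x. \<Sum>a\<in>A. a * x * g a) (A \<rightarrow>\<^sub>E L) (bimult L)"
      unfolding bij_betw_def
    proof
      show "inj_on (\<lambda>g x. \<Sum>a\<in>A. a * x * g a) (A \<rightarrow>\<^sub>E L)"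
      proof (rule inj_onI, rule ccontr)
        fix g g' assume g: "g \<in> A \<rightarrow>\<^sub>E L" "g' \<in> A \<rightarrow>\<^sub>E L" "g \<noteq> g'"
          and eq: "(\<lambda>x. \<Sum>a\<in>A. a * x * g a) = (\<lambda>x. \<Sum>a\<in>A. a * x * g' a)"
        then obtain a0 where a0: "a0 \<in> A" "g a0 \<noteq> g' a0" using PiE_ext[of g A "\<lambda>_. L" g'] by blast
        define c where "c a = g a - g' a" for a
        have c0: "c a0 \<noteq> 0" using a0 by (simp add: c_def)
        have "a0 * x = (\<Sum>a\<in>A - {a0}. a * x * (- c a * inverse (c a0)))" for x
        proof -
          have "(\<Sum>a\<in>A. a * x * c a) = 0"
            using fun_cong[OF eq, of x] by (simp add: c_def right_diff_distrib sum_subtractf)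
          then have "a0 * x * c a0 = - (\<Sum>a\<in>A - {a0}. a * x * c a)"
            by (simp add: sum.remove[OF finA a0(1)] eq_neg_iff_add_eq_0)
          moreover have "a0 * x = a0 * x * c a0 * inverse (c a0)" using c0 by (simp add: mult.assoc)
          ultimately show ?thesis by (simp add: sum_distrib_right sum_negf[symmetric] mult.assoc)
        qed
        then have "a0 \<in> D.span (A - {a0})" by (rule two_sided_dependence[rotated]) (use finA in simp)
        then obtain u where "a0 = (\<Sum>a\<in>A - {a0}. center_scale (u a) a)"
          using D.span_finite[of "A - {a0}"] finA by auto
        then have "a0 = (\<Sum>a\<in>A - {a0}. a * of_center (u a))"
          by (simp add: center_scale_def of_center_commute)
        moreover have "\<forall>a\<in>A - {a0}. of_center (u a) \<in> Z" by (simp add: Z_def)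
        ultimately have "\<exists>g. (\<forall>a\<in>A - {a0}. g a \<in> Z) \<and> a0 = (\<Sum>a\<in>A - {a0}. a * g a)"
          by (intro exI[of _ "\<lambda>a. of_center (u a)"] conjI)
        then show False
          using bspec[OF right_basis_independent[OF A finA Z_def, unfolded right_independent_def] a0(1)]
          by contradiction
      qed
      show "(\<lambda>g x. \<Sum>a\<in>A. a * x * g a) ` (A \<rightarrow>\<^sub>E L) = bimult L"
      proof
        show "(\<lambda>g x. \<Sum>a\<in>A. a * x * g a) ` (A \<rightarrow>\<^sub>E L) \<subseteq> bimult L"
        proof (rule image_subsetI)
          fix g assume "g \<in> A \<rightarrow>\<^sub>E L"
          then show "(\<lambda>x. \<Sum>a\<in>A. a * x * g a) \<in> bimult L"
            by (intro bimult_sumI[OF L] bimult.mult) auto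
        qed
        show "bimult L \<subseteq> (\<lambda>g x. \<Sum>a\<in>A. a * x * g a) ` (A \<rightarrow>\<^sub>E L)"
        proof
          fix \<phi> assume "\<phi> \<in> bimult L"
          then have "\<exists>g. (\<forall>a\<in>A. g a \<in> L) \<and> \<phi> = (\<lambda>x. \<Sum>a\<in>A. a * x * g a)"
          proof (induction rule: bimult.induct)
            case (mult l d)
            have "d \<in> (\<lambda>g. \<Sum>b\<in>A. b * g b) ` (A \<rightarrow>\<^sub>E Z)" using A by (simp add: bij_betw_def)
            then obtain g where g: "g \<in> A \<rightarrow>\<^sub>E Z" and d: "d = (\<Sum>a\<in>A. a * g a)" by blast
            have gx: "g a * x = x * g a" if "a \<in> A" for a x
            proof -
              have "g a \<in> Z" using g that by auto
              then show ?thesis unfolding Z_def centralizer_def by auto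
            qed
            have "d * x * l = (\<Sum>a\<in>A. a * x * (g a * l))" for x
              unfolding d sum_distrib_right
            proof (rule sum.cong[OF refl])
              fix a assume "a \<in> A"
              have "a * g a * x * l = a * (g a * x) * l" by (simp only: mult.assoc)
              also have "\<dots> = a * (x * g a) * l" by (simp only: gx[OF \<open>a \<in> A\<close>])
              finally show "a * g a * x * l = a * x * (g a * l)" by (simp only: mult.assoc)
            qed
            moreover have "\<forall>a\<in>A. g a * l \<in> L" using g ZL mult by (auto intro!: zL)
            ultimately show ?case by (intro exI[of _ "\<lambda>a. g a * l"]) auto
          next
            case (add \<phi> \<psi>)
            then obtain g h where g: "\<forall>a\<in>A. g a \<in> L" "\<phi> = (\<lambda>x. \<Sum>a\<in>A. a * x * g a)"
              and h: "\<forall>a\<in>A. h a \<in> L" "\<psi> = (\<lambda>x. \<Sum>a\<in>A. a * x * h a)" by blast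
            have "\<forall>a\<in>A. g a + h a \<in> L" using g h sL by blast
            moreover have "(\<lambda>x. \<phi> x + \<psi> x) = (\<lambda>x. \<Sum>a\<in>A. a * x * (g a + h a))"
              by (simp add: g(2) h(2) distrib_left sum.distrib)
            ultimately show ?case by (intro exI[of _ "\<lambda>a. g a + h a"] conjI)
          qed
          then obtain g where g: "\<forall>a\<in>A. g a \<in> L" "\<phi> = (\<lambda>x. \<Sum>a\<in>A. a * x * g a)" by blast
          then have "\<phi> = (\<lambda>x. \<Sum>a\<in>A. a * x * restrict g A a)" by simp
          moreover have "restrict g A \<in> A \<rightarrow>\<^sub>E L" using g(1) by auto
          ultimately show "\<phi> \<in> (\<lambda>g x. \<Sum>a\<in>A. a * x * g a) ` (A \<rightarrow>\<^sub>E L)" by (rule image_eqI)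
        qed
      qed
    qed
    then have "card (bimult L) = card L ^ card A"
      using finA by (simp add: bij_betw_same_card[symmetric] card_funcsetE)
    then have "card L ^ card A = card L ^ (card B * card B)"
      using c1 card_D by (simp add: power_mult)
    moreover have "1 < card L"
    proof -
      have "{0, 1} \<subseteq> L" using zero_in_centralizer[of L] one_in_centralizer[of L] L by simp
      then have "card {0, 1 :: 'a} \<le> card L"
        by (rule card_mono[OF finite_subset[OF subset_UNIV fin]])
      then show ?thesis by simp
    qed
    ultimately have "card A = card B * card B" by (simp add: power_inject_exp)
    moreover have "0 < card B"
    proof (rule ccontr)
      assume "\<not> 0 < card B"
      then have "card (UNIV :: 'a set) = 1" using card_D by simp
      then obtain u :: 'a where "UNIV = {u}" by (auto simp: card_1_singleton_iff)
      then have "(0 :: 'a) = 1" by (metis UNIV_I singletonD)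
      then show False by simp
    qed
    ultimately show ?thesis using card_D by blast
  qed
  obtain r s where r: "r > 0" "card A = r * r" "card L ^ r = card (UNIV :: 'a set)"
    and s: "card A = s * s" "card M ^ s = card (UNIV :: 'a set)" using main[OF L] main[OF M] by blast
  have "r = s" using r(2) s(1) by (metis power2_eq_square power_inject_base zero_le power2_eq_iff_nonneg)
  then show ?thesis using r s power_eq_iff_eq_base[of r "card L" "card M"] by simp
qed

section \<open>A self-centralizing subfield as a type\<close>

text \<open>One self-centralizing subfield is made into a type, so that \<open>D\<close> becomes a right vector space
  over a field in the sense of the library.\<close>

definition chosen_subfield :: "'a :: division_ring set" where
  "chosen_subfield = (SOME L. centralizer L = L)"

lemma centralizer_chosen_subfield: "centralizer chosen_subfield = chosen_subfield"
  unfolding chosen_subfield_def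
proof (rule someI_ex)
  show "\<exists>L :: 'a set. centralizer L = L"
    using ex_self_centralizing[of "{}"] by auto
qed

typedef (overloaded) ('a :: division_ring) maxfield = "chosen_subfield :: 'a set"
  morphisms of_maxfield Abs_maxfield
  using zero_in_centralizer[of chosen_subfield] unfolding centralizer_chosen_subfield by blast

setup_lifting type_definition_maxfield

lemmas chosen_subfield_closed =
  centralizer_closed[of _ chosen_subfield, unfolded centralizer_chosen_subfield]
  zero_in_centralizer[of chosen_subfield, unfolded centralizer_chosen_subfield]
  one_in_centralizer[of chosen_subfield, unfolded centralizer_chosen_subfield]
  of_center_in_centralizer[of _ chosen_subfield, unfolded centralizer_chosen_subfield]

lemma chosen_subfield_commute:
  "x \<in> chosen_subfield \<Longrightarrow> y \<in> chosen_subfield \<Longrightarrow> x * y = y * x"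
  using centralizerD[of x chosen_subfield y] unfolding centralizer_chosen_subfield by blast

instantiation maxfield :: (division_ring) field
begin

lift_definition zero_maxfield :: "'a maxfield" is 0 by (rule chosen_subfield_closed)
lift_definition one_maxfield :: "'a maxfield" is 1 by (rule chosen_subfield_closed)
lift_definition plus_maxfield :: "'a maxfield \<Rightarrow> 'a maxfield \<Rightarrow> 'a maxfield" is "(+)"
  by (rule chosen_subfield_closed)
lift_definition minus_maxfield :: "'a maxfield \<Rightarrow> 'a maxfield \<Rightarrow> 'a maxfield" is "(-)"
  by (rule chosen_subfield_closed)
lift_definition uminus_maxfield :: "'a maxfield \<Rightarrow> 'a maxfield" is uminus
  by (rule chosen_subfield_closed)
lift_definition times_maxfield :: "'a maxfield \<Rightarrow> 'a maxfield \<Rightarrow> 'a maxfield" is "(*)"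
  by (rule chosen_subfield_closed)
lift_definition inverse_maxfield :: "'a maxfield \<Rightarrow> 'a maxfield" is inverse
  by (rule chosen_subfield_closed)
lift_definition divide_maxfield :: "'a maxfield \<Rightarrow> 'a maxfield \<Rightarrow> 'a maxfield"
  is "\<lambda>x y. x * inverse y"
  by (intro chosen_subfield_closed)

instance
proof
  fix x y z :: "'a maxfield"
  show "x + y + z = x + (y + z)" by transfer (rule add.assoc)
  show "x + y = y + x" by transfer (rule add.commute)
  show "0 + x = x" by transfer simp
  show "- x + x = 0" by transfer simp
  show "x - y = x + - y" by transfer simp
  show "x * y * z = x * (y * z)" by transfer (rule mult.assoc)
  show "x * y = y * x" by transfer (rule chosen_subfield_commute)
  show "1 * x = x" by transfer simp
  show "(x + y) * z = x * z + y * z" by transfer (rule distrib_right)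
  show "(0 :: 'a maxfield) \<noteq> 1" by transfer (rule zero_neq_one)
  show "x \<noteq> 0 \<Longrightarrow> inverse x * x = 1" by transfer (rule left_inverse)
  show "x div y = x * inverse y" by transfer (rule refl)
  show "inverse (0 :: 'a maxfield) = 0" by transfer (rule inverse_zero)
qed

end

lemma range_of_maxfield: "range of_maxfield = chosen_subfield"
  using type_definition.Rep_range[OF type_definition_maxfield] .

lemmas of_maxfield_hom = zero_maxfield.rep_eq one_maxfield.rep_eq plus_maxfield.rep_eq
  minus_maxfield.rep_eq times_maxfield.rep_eq inverse_maxfield.rep_eq

lemma of_maxfield_power: "of_maxfield (l ^ k) = of_maxfield l ^ k"
  by (induction k) (simp_all add: of_maxfield_hom)

lemma of_maxfield_sum: "of_maxfield (sum g I) = (\<Sum>i\<in>I. of_maxfield (g i))"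
  by (induction I rule: infinite_finite_induct) (simp_all add: of_maxfield_hom)

section \<open>Finite division rings are commutative\<close>

text \<open>As \<open>k\<close> is too small for all nonzero elements to be roots of \<open>x ^ k - 1\<close>, there is \<open>g\<close> with
  \<open>g ^ k \<noteq> 1\<close>; replacing \<open>h\<close> by \<open>g * h\<close> permutes the summands and multiplies the sum by
  \<open>inverse g ^ k\<close>.\<close>

lemma finite_field_power_sum_eq_0:
  fixes k :: nat
  assumes fin: "finite (UNIV :: 'l :: field set)" and "0 < k" "k < CARD('l) - 1"
  shows "(\<Sum>h\<in>UNIV - {0 :: 'l}. inverse h ^ k) = 0"
proof -
  let ?p = "Polynomial.monom 1 k - 1 :: 'l poly"
  have "\<exists>g :: 'l. g \<noteq> 0 \<and> g ^ k \<noteq> 1"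
  proof (rule ccontr)
    assume "\<not> ?thesis"
    then have "UNIV - {0} \<subseteq> {g. poly ?p g = 0}" by (auto simp: poly_monom)
    then have "card (UNIV - {0 :: 'l}) \<le> card {g. poly ?p g = 0}"
      by (rule card_mono[OF finite_subset[OF subset_UNIV fin]])
    also have "coeff ?p k = 1" using \<open>0 < k\<close> by simp
    then have "?p \<noteq> 0" by (metis coeff_0 zero_neq_one)
    then have "card {g. poly ?p g = 0} \<le> degree ?p" by (rule card_poly_roots_bound)
    also have "degree ?p \<le> k" by (rule degree_diff_le) (simp_all add: degree_monom_le)
    finally show False using assms by simp
  qed
  then obtain g :: 'l where g: "g \<noteq> 0" "g ^ k \<noteq> 1" by blast
  have "bij_betw ((*) g) (UNIV - {0}) (UNIV - {0})"
    by (rule bij_betw_byWitness[of _ "\<lambda>h. inverse g * h"]) (use g in \<open>auto simp: field_simps\<close>)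
  then have "(\<Sum>h\<in>UNIV - {0}. inverse h ^ k) = (\<Sum>h\<in>UNIV - {0}. inverse (g * h) ^ k)"
    by (rule sum.reindex_bij_betw[symmetric])
  also have "\<dots> = inverse g ^ k * (\<Sum>h\<in>UNIV - {0}. inverse h ^ k)"
    by (simp add: sum_distrib_left power_mult_distrib)
  finally have "(1 - inverse g ^ k) * (\<Sum>h\<in>UNIV - {0}. inverse h ^ k) = 0"
    by (simp add: left_diff_distrib)
  moreover have "inverse g ^ k \<noteq> 1" using g by (simp add: power_inverse inverse_eq_1_iff)
  ultimately show ?thesis by simp
qed

lemma finite_field_of_nat_card:
  assumes fin: "finite (UNIV :: 'l :: field set)"
  shows "(of_nat CARD('l) :: 'l) = 0"
proof -
  have "bij_betw (\<lambda>g. g + 1) UNIV (UNIV :: 'l set)"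
    by (rule bij_betw_byWitness[of _ "\<lambda>g. g - 1"]) auto
  then have "(\<Sum>g\<in>UNIV. g) = (\<Sum>g\<in>UNIV. g + 1 :: 'l)"
    by (rule sum.reindex_bij_betw[symmetric])
  then show ?thesis by (simp add: sum.distrib)
qed

text \<open>The product of all nonzero elements does not change when each of them is multiplied by \<open>x\<close>. The
  product runs along a list, since multiplication commutes only within \<open>L\<close>.\<close>

lemma self_centralizing_power_eq_1:
  fixes L :: "'a :: division_ring set"
  assumes L: "centralizer L = L" and fin: "finite L" and x: "x \<in> L" "x \<noteq> 0"
  shows "x ^ (card L - 1) = 1"
proof -
  obtain xs where xs: "set xs = L - {0}" "distinct xs"
    using finite_distinct_list[of "L - {0}"] fin by auto
  have comm: "y * z = z * y" if "y \<in> L" "z \<in> L" for y z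
    using centralizerD[of y L z] that L by simp
  have "((*) x) ` (L - {0}) = L - {0}"
  proof (rule card_subset_eq)
    show "((*) x) ` (L - {0}) \<subseteq> L - {0}"
      using x centralizer_mult[of x L] L by auto
    show "card ((*) x ` (L - {0})) = card (L - {0})"
      by (rule card_image) (use x in \<open>auto intro: inj_onI\<close>)
  qed (use fin in simp)
  then have "mset (map ((*) x) xs) = mset xs"
    using xs x by (intro set_eq_iff_mset_eq_distinct[THEN iffD1]) (auto simp: distinct_map inj_on_def)
  then have "fold (*) (map ((*) x) xs) 1 = fold (*) xs 1"
    by (intro fun_cong[OF fold_multiset_equiv])
      (use xs x comm centralizer_mult[of x L] L in \<open>auto simp: fun_eq_iff mult.assoc[symmetric]\<close>)
  moreover have "fold (*) (map ((*) x) ys) (x ^ k * t) = x ^ (length ys + k) * fold (*) ys t"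
    if "set ys \<subseteq> L" for ys k t using that
  proof (induction ys arbitrary: k t)
    case (Cons y ys)
    have "y * x = x * y" using comm[of x y] x Cons.prems by simp
    then have "y * x ^ k = x ^ k * y" by (metis power_commuting_commutes)
    then have "x * y * (x ^ k * t) = x ^ Suc k * (y * t)"
      by (simp only: mult.assoc power_Suc) (simp only: mult.assoc[symmetric])
    then show ?case using Cons.IH[of "Suc k" "y * t"] Cons.prems by simp
  qed simp
  from this[of xs 0 1] have "fold (*) (map ((*) x) xs) 1 = x ^ length xs * fold (*) xs 1"
    using xs by auto
  moreover have "fold (*) ys t \<noteq> 0" if "0 \<notin> set ys" "t \<noteq> 0" for ys and t :: 'a using that
    by (induction ys arbitrary: t) auto
  from this[of xs 1] have "fold (*) xs 1 \<noteq> (0 :: 'a)" using xs by simp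
  moreover have "length xs = card L - 1"
    using distinct_card[OF xs(2)] xs(1) fin zero_in_centralizer[of L] L by simp
  ultimately show ?thesis by simp
qed

text \<open>Let \<open>q\<close> be the common cardinality of the self-centralizing subfields, so that
  \<open>x ^ (q - 1) = 1\<close> for all \<open>x \<noteq> 0\<close>. For nonzero \<open>h\<close> in a fixed one of these subfields,
  \<open>w h = (\<Sum>k<q-1. x ^ k * inverse h ^ k)\<close> satisfies \<open>x * w h = w h * h\<close>. Summed over \<open>h\<close>, only the
  terms with \<open>k = 0\<close> survive, and the total is \<open>q - 1 = -1\<close>; so some \<open>w h\<close> is nonzero and \<open>x\<close> is
  conjugate into the subfield. But the conjugates of a proper subgroup do not cover a finite
  group: choosing for each \<open>x \<notin> {0, 1}\<close> a conjugating element, determined up to a factor from the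
  subfield, and a conjugate \<open>h \<notin> {0, 1}\<close>, yields an injection that forces the subfield to be everything.\<close>

theorem finite_division_ring_commutative:
  fixes x y :: "'a :: division_ring"
  assumes fin: "finite (UNIV :: 'a set)"
  shows "x * y = y * x"
proof -
  let ?L = "chosen_subfield :: 'a set"
  have finL: "finite (UNIV :: 'a maxfield set)"
    using finite_imageD[of of_maxfield UNIV] finite_subset[OF subset_UNIV fin]
    by (metis of_maxfield_inject injI)
  define e where "e = card ?L - 1"
  have cardL: "CARD('a maxfield) = card ?L"
    unfolding range_of_maxfield[symmetric] by (rule card_image[symmetric]) (simp add: inj_def of_maxfield_inject)
  have pow: "x ^ e = 1" if "x \<noteq> 0" for x :: 'a
  proof -
    obtain M where M: "x \<in> M" "centralizer M = M"
      using ex_self_centralizing[of "{x}"] by (auto simp: centralizer_def)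
    have "finite M" by (rule finite_subset[OF subset_UNIV fin])
    from self_centralizing_power_eq_1[OF M(2) this M(1) that] show ?thesis
      using self_centralizing_card_eq[OF fin M(2) centralizer_chosen_subfield] by (simp add: e_def)
  qed
  have conj: "\<exists>w h. w \<noteq> 0 \<and> h \<noteq> 0 \<and> x * w = w * of_maxfield h" if x: "x \<noteq> 0" for x :: 'a
  proof -
    define v where "v h k = x ^ k * of_maxfield (inverse h) ^ k" for h k
    define w where "w h = (\<Sum>k<e. v h k)" for h
    have eig: "x * w h = w h * of_maxfield h" if h: "h \<noteq> 0" for h
    proof -
      let ?h = "of_maxfield h"
      have h0: "?h \<noteq> 0" using h by (metis of_maxfield_inject zero_maxfield.rep_eq)
      have "v h 0 = v h e" using pow[OF x] pow[of "inverse ?h"] h0 by (simp add: v_def of_maxfield_hom)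
      moreover have "v h 0 + (\<Sum>k<e. v h (Suc k)) = (\<Sum>k<e. v h k) + v h e"
        by (simp only: sum.lessThan_Suc_shift[symmetric] sum.lessThan_Suc)
      ultimately have "(\<Sum>k<e. v h (Suc k)) = w h" by (simp add: w_def)
      moreover have "v h (Suc k) = x * v h k * inverse ?h" for k
        unfolding v_def power_Suc[of x] power_Suc2[of "of_maxfield (inverse h)"]
        by (simp add: mult.assoc of_maxfield_hom)
      ultimately have "x * w h * inverse ?h = w h"
        by (simp add: w_def sum_distrib_left sum_distrib_right)
      then have "w h * ?h = x * w h * (inverse ?h * ?h)" by (metis mult.assoc)
      then show ?thesis using h0 by simp
    qed
    have "e > 0"
    proof -
      have "{0, 1} \<subseteq> ?L" by (simp add: chosen_subfield_closed)
      then have "card {0, 1 :: 'a} \<le> card ?L" by (rule card_mono[OF finite_subset[OF subset_UNIV fin]])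
      then show ?thesis by (simp add: e_def)
    qed
    have "(\<Sum>h\<in>UNIV - {0}. w h) = (\<Sum>k<e. \<Sum>h\<in>UNIV - {0}. v h k)"
      unfolding w_def by (rule sum.swap)
    also have "\<dots> = (\<Sum>k<e. x ^ k * of_maxfield (\<Sum>h\<in>UNIV - {0}. inverse h ^ k))"
      by (simp add: v_def of_maxfield_sum of_maxfield_power sum_distrib_left)
    also have "\<dots> = (\<Sum>k<e. if k = 0 then - 1 else 0)"
    proof (rule sum.cong[OF refl])
      fix k assume k: "k \<in> {..<e}"
      show "x ^ k * of_maxfield (\<Sum>h\<in>UNIV - {0}. inverse h ^ k) = (if k = 0 then - 1 else 0)"
      proof (cases "k = 0")
        case True
        have "(\<Sum>h\<in>UNIV - {0}. inverse h ^ k) = (of_nat (CARD('a maxfield) - 1) :: 'a maxfield)"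
          using True finL by simp
        also have "\<dots> = - 1"
          using finite_field_of_nat_card[OF finL] \<open>e > 0\<close> cardL by (simp add: of_nat_diff e_def)
        finally show ?thesis using True by (simp add: uminus_maxfield.rep_eq of_maxfield_hom)
      next
        case False
        then have "(\<Sum>h\<in>UNIV - {0 :: 'a maxfield}. inverse h ^ k) = 0"
          using k by (intro finite_field_power_sum_eq_0[OF finL]) (auto simp: cardL e_def)
        then show ?thesis using False by (simp add: of_maxfield_hom)
      qed
    qed
    also have "\<dots> = - 1" using \<open>e > 0\<close> by simp
    finally have "(\<Sum>h\<in>UNIV - {0}. w h) \<noteq> 0" by simp
    then obtain h where "h \<in> UNIV - {0}" "w h \<noteq> 0"
      using sum.neutral[of "UNIV - {0}" w] by blast
    then show ?thesis using eig[of h] by blast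
  qed
  then obtain W H where WH: "\<And>x :: 'a. x \<noteq> 0 \<Longrightarrow> W x \<noteq> 0 \<and> H x \<noteq> 0 \<and> x * W x = W x * of_maxfield (H x)"
    by metis
  \<comment> \<open>\<open>x\<close> is recovered from its image, being the conjugate of \<open>H x\<close> by \<open>W x * l\<close>.\<close>
  let ?f = "\<lambda>(x, l). (W x * of_maxfield l, H x)"
  let ?A = "(UNIV - {0, 1 :: 'a}) \<times> (UNIV - {0 :: 'a maxfield})"
  let ?B = "(UNIV - {0 :: 'a}) \<times> (UNIV - {0, 1 :: 'a maxfield})"
  have nz: "of_maxfield l \<noteq> 0" if "l \<noteq> 0" for l :: "'a maxfield"
    using that by (metis of_maxfield_inject zero_maxfield.rep_eq)
  have rec: "x * (W x * of_maxfield l) = W x * of_maxfield l * of_maxfield (H x)" if "x \<noteq> 0" for x l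
  proof -
    have "x * (W x * of_maxfield l) = W x * (of_maxfield (H x) * of_maxfield l)"
      using WH[OF that] by (simp add: mult.assoc[symmetric])
    also have "of_maxfield (H x) * of_maxfield l = of_maxfield l * of_maxfield (H x)"
      by (simp add: of_maxfield_hom[symmetric] mult.commute)
    finally show ?thesis by (simp add: mult.assoc)
  qed
  have "inj_on ?f ?A"
  proof (rule inj_onI)
    fix p p' assume p: "p \<in> ?A" "p' \<in> ?A" "?f p = ?f p'"
    obtain x l x' l' where pp: "p = (x, l)" "p' = (x', l')" by (metis surj_pair)
    have a: "x \<noteq> 0" "x' \<noteq> 0" "l \<noteq> 0" "l' \<noteq> 0"
      and eq: "W x * of_maxfield l = W x' * of_maxfield l'" "H x = H x'" using p by (auto simp: pp)
    let ?w = "W x * of_maxfield l"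
    have "?w \<noteq> 0" using WH[of x] nz[of l] a by simp
    moreover have "x * ?w = x' * ?w" using rec[of x l] rec[of x' l'] a eq by simp
    ultimately have "x = x'" by simp
    then show "p = p'" using eq a WH[of x] by (simp add: pp of_maxfield_inject)
  qed
  moreover have "?f ` ?A \<subseteq> ?B"
  proof (rule image_subsetI)
    fix p assume p: "p \<in> ?A"
    obtain x l where pp: "p = (x, l)" by (metis surj_pair)
    have a: "x \<noteq> 0" "x \<noteq> 1" "l \<noteq> 0" using p by (auto simp: pp)
    have "H x \<noteq> 1"
    proof
      assume "H x = 1"
      then have "(x - 1) * W x = 0" using WH[of x] a by (simp add: of_maxfield_hom left_diff_distrib)
      then show False using WH[of x] a by simp
    qed
    then show "?f p \<in> ?B" using WH[of x] nz[of l] a by (simp add: pp)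
  qed
  ultimately have "card ?A \<le> card ?B"
    using fin finL by (intro card_inj_on_le) auto
  then have le: "(CARD('a) - 2) * (CARD('a maxfield) - 1) \<le> (CARD('a) - 1) * (CARD('a maxfield) - 2)"
    using fin finL by (simp add: card_cartesian_product card_Diff_subset numeral_2_eq_2)
  have le2: "card ?L \<le> CARD('a)" by (rule card_mono[OF fin subset_UNIV])
  have "CARD('a) \<le> card ?L"
  proof -
    have "2 \<le> CARD('a maxfield)"
      using card_mono[OF finL, of "{0, 1}"] by simp
    then obtain b where b: "CARD('a maxfield) = b + 2" by (metis add.commute le_Suc_ex)
    then obtain a where a: "CARD('a) = a + 2" using le2 cardL by (metis add.commute le_Suc_ex le_add2 le_trans)
    show ?thesis using le b a cardL by (simp add: algebra_simps)
  qed
  then have "?L = UNIV" using card_seteq[OF fin subset_UNIV] by blast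
  then show ?thesis using chosen_subfield_commute[of x y] by simp
qed

section \<open>Cyclicity is an open condition\<close>

(* In this section the infix stands for the scalar multiplication of the locale only. *)
no_notation vector_scalar_mult (infixl "*s" 70)

definition cyclic_vector ::
    "('l :: field \<Rightarrow> 'b \<Rightarrow> 'b) \<Rightarrow> ('b \<Rightarrow> 'b) \<Rightarrow> 'b :: ab_group_add \<Rightarrow> bool" where
  "cyclic_vector smul T v \<longleftrightarrow> module.span smul (range (\<lambda>k. (T ^^ k) v)) = UNIV"

definition linear_map :: "('l \<Rightarrow> 'b \<Rightarrow> 'b) \<Rightarrow> ('b \<Rightarrow> 'b :: ab_group_add) \<Rightarrow> bool" where
  "linear_map smul T \<longleftrightarrow> (\<forall>x y. T (x + y) = T x + T y) \<and> (\<forall>c x. T (smul c x) = smul c (T x))"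

definition linear_form :: "('l \<Rightarrow> 'b \<Rightarrow> 'b) \<Rightarrow> ('b :: ab_group_add \<Rightarrow> 'l :: field) \<Rightarrow> bool" where
  "linear_form smul p \<longleftrightarrow> (\<forall>x y. p (x + y) = p x + p y) \<and> (\<forall>c x. p (smul c x) = c * p x)"

text \<open>A weak notion of polynomial curve, requiring polynomial coordinates without bounding their
  degrees; it makes the closure properties trivial.\<close>

definition polynomial_curve ::
    "('l :: field \<Rightarrow> 'b \<Rightarrow> 'b) \<Rightarrow> ('l \<Rightarrow> 'b :: ab_group_add) \<Rightarrow> bool" where
  "polynomial_curve smul w \<longleftrightarrow> (\<forall>p. linear_form smul p \<longrightarrow> (\<exists>q. \<forall>s. p (w s) = poly q s))"

text \<open>Linear independence of families rather than sets: along a curve the vectors move and may coincide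
  at exceptional parameters, while the index set stays fixed.\<close>

definition independent_family ::
    "('l :: field \<Rightarrow> 'b \<Rightarrow> 'b) \<Rightarrow> 'i set \<Rightarrow> ('i \<Rightarrow> 'b :: ab_group_add) \<Rightarrow> bool" where
  "independent_family smul I w \<longleftrightarrow>
     (\<forall>\<alpha>. (\<Sum>i\<in>I. smul (\<alpha> i) (w i)) = 0 \<longrightarrow> (\<forall>i\<in>I. \<alpha> i = 0))"

context vector_space
begin

lemma linear_mapD:
  fixes T :: "'b \<Rightarrow> 'b" and x y :: 'b
  assumes "linear_map scale T"
  shows "T (x + y) = T x + T y" "T (c *s x) = c *s T x" "T 0 = 0" "T (x - y) = T x - T y"
    "T (sum g I) = (\<Sum>i\<in>I. T (g i))"
proof -
  show a: "T (x + y) = T x + T y" "T (c *s x) = c *s T x" for x y :: 'b and c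
    using assms by (simp_all add: linear_map_def)
  show z: "T 0 = 0" using a(1)[of 0 0] by simp
  show "T (x - y) = T x - T y" using a(1)[of "x - y" y] by (simp add: eq_diff_eq)
  show "T (sum g I) = (\<Sum>i\<in>I. T (g i))"
    by (induction I rule: infinite_finite_induct) (simp_all add: z a(1))
qed

lemma linear_formD:
  fixes p :: "'b \<Rightarrow> 'a" and x y :: 'b
  assumes "linear_form scale p"
  shows "p (x + y) = p x + p y" "p (c *s x) = c * p x" "p (x - y) = p x - p y"
    "p (sum g I) = (\<Sum>i\<in>I. p (g i))"
proof -
  show a: "p (x + y) = p x + p y" "p (c *s x) = c * p x" for x y :: 'b and c
    using assms by (simp_all add: linear_form_def)
  have z: "p 0 = 0" using a(2)[of 0 0] by simp
  show "p (x - y) = p x - p y" using a(1)[of "x - y" y] by (simp add: eq_diff_eq)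
  show "p (sum g I) = (\<Sum>i\<in>I. p (g i))"
    by (induction I rule: infinite_finite_induct) (simp_all add: z a(1))
qed

lemma ex_linear_form:
  assumes "x \<noteq> 0"
  shows "\<exists>p. linear_form scale p \<and> p x \<noteq> 0"
proof -
  have x: "independent {x}" using assms by simp
  let ?B = "extend_basis {x}"
  have B: "independent ?B" "span ?B = UNIV" "x \<in> ?B"
    using independent_extend_basis[OF x] span_extend_basis[OF x] extend_basis_superset[OF x] by auto
  have "linear_form scale (\<lambda>y. representation ?B y x)"
    unfolding linear_form_def
    by (simp add: representation_add[OF B(1)] representation_scale[OF B(1)] B(2))
  moreover have "representation ?B x x = 1"
    using representation_basis[OF B(1,3)] by simp
  ultimately show ?thesis by (intro exI[of _ "\<lambda>y. representation ?B y x"]) simp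
qed

lemma polynomial_curve_const: "polynomial_curve scale (\<lambda>s. x)"
  unfolding polynomial_curve_def
proof (intro allI impI)
  fix p
  have "\<forall>s. p x = poly [:p x:] s" by simp
  then show "\<exists>q. \<forall>s. p x = poly q s" by blast
qed

lemma polynomial_curve_add:
  assumes "polynomial_curve scale v" "polynomial_curve scale w"
  shows "polynomial_curve scale (\<lambda>s. v s + w s)"
  unfolding polynomial_curve_def
proof (intro allI impI)
  fix p assume p: "linear_form scale p"
  obtain q r where "\<forall>s. p (v s) = poly q s" "\<forall>s. p (w s) = poly r s"
    using assms p unfolding polynomial_curve_def by blast
  then have "\<forall>s. p (v s + w s) = poly (q + r) s" by (simp add: linear_formD[OF p])
  then show "\<exists>q. \<forall>s. p (v s + w s) = poly q s" by blast
qed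

lemma polynomial_curve_scale:
  assumes "polynomial_curve scale w"
  shows "polynomial_curve scale (\<lambda>s. poly r s *s w s)"
  unfolding polynomial_curve_def
proof (intro allI impI)
  fix p assume p: "linear_form scale p"
  obtain q where "\<forall>s. p (w s) = poly q s"
    using assms p unfolding polynomial_curve_def by blast
  then have "\<forall>s. p (poly r s *s w s) = poly (r * q) s" by (simp add: linear_formD[OF p])
  then show "\<exists>q. \<forall>s. p (poly r s *s w s) = poly q s" by blast
qed

lemma polynomial_curve_linear_map:
  assumes "polynomial_curve scale w" and T: "linear_map scale T"
  shows "polynomial_curve scale (\<lambda>s. T (w s))"
  unfolding polynomial_curve_def
proof (intro allI impI)
  fix p assume p: "linear_form scale p"
  have "linear_form scale (\<lambda>x. p (T x))"
    unfolding linear_form_def by (simp add: linear_formD[OF p] linear_mapD[OF T])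
  then show "\<exists>q. \<forall>s. p (T (w s)) = poly q s"
    using assms(1)[unfolded polynomial_curve_def, rule_format, of "\<lambda>x. p (T x)"] by blast
qed

lemma independent_familyD:
  "independent_family scale I w \<Longrightarrow> (\<Sum>i\<in>I. \<alpha> i *s w i) = 0 \<Longrightarrow> i \<in> I \<Longrightarrow> \<alpha> i = 0"
  unfolding independent_family_def by blast

text \<open>Gaussian elimination with polynomial entries: a linear form not vanishing on the \<open>j\<close>-th curve at
  \<open>s0\<close> serves to clear it from the other curves, at all but finitely many parameters.\<close>

lemma independent_family_cofinite:
  fixes w :: "'i \<Rightarrow> 'a \<Rightarrow> 'b"
  assumes "finite I" and "\<And>i. i \<in> I \<Longrightarrow> polynomial_curve scale (w i)"
    and "independent_family scale I (\<lambda>i. w i s0)"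
  shows "finite {s. \<not> independent_family scale I (\<lambda>i. w i s)}"
  using assms
proof (induction I arbitrary: w rule: finite_induct)
  case empty
  then show ?case by (simp add: independent_family_def)
next
  case (insert j I)
  have sums: "(\<Sum>i\<in>insert j I. g i) = g j + (\<Sum>i\<in>I. g i)" for g :: "'i \<Rightarrow> 'b"
    using insert.hyps by simp
  have wj: "w j s0 \<noteq> 0"
  proof
    assume "w j s0 = 0"
    then have "(\<Sum>i\<in>insert j I. (if i = j then 1 else 0) *s w i s0) = 0"
      by (intro sum.neutral) auto
    from independent_familyD[OF insert.prems(2) this, of j] show False by simp
  qed
  then obtain p where p: "linear_form scale p" "p (w j s0) \<noteq> 0" using ex_linear_form by blast
  have "\<exists>q. \<forall>i\<in>insert j I. \<forall>s. p (w i s) = poly (q i) s"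
    by (rule bchoice) (use insert.prems(1) p(1) in \<open>auto simp: polynomial_curve_def\<close>)
  then obtain q where q: "\<And>i s. i \<in> insert j I \<Longrightarrow> p (w i s) = poly (q i) s" by blast
  have qj: "q j \<noteq> 0" using q[of j s0] p(2) by auto
  define w' where "w' i s = poly (q j) s *s w i s + poly (- q i) s *s w j s" for i s
  have elim: "(\<Sum>i\<in>I. \<alpha> i *s w' i s)
      = (\<Sum>i\<in>insert j I. (if i = j then - (\<Sum>k\<in>I. \<alpha> k * poly (q k) s) else \<alpha> i * poly (q j) s) *s w i s)"
    for \<alpha> s
  proof -
    have "(\<Sum>i\<in>I. \<alpha> i *s w' i s)
        = (\<Sum>i\<in>I. (\<alpha> i * poly (q j) s) *s w i s) + - (\<Sum>k\<in>I. \<alpha> k * poly (q k) s) *s w j s"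
      by (simp add: w'_def scale_right_distrib sum.distrib scale_sum_left sum_negf scale_right_diff_distrib sum_subtractf)
    also have "(\<Sum>i\<in>I. (\<alpha> i * poly (q j) s) *s w i s)
        = (\<Sum>i\<in>I. (if i = j then - (\<Sum>k\<in>I. \<alpha> k * poly (q k) s) else \<alpha> i * poly (q j) s) *s w i s)"
      by (rule sum.cong) (use insert.hyps in auto)
    finally show ?thesis unfolding sums by (simp add: add.commute)
  qed
  have "finite {s. \<not> independent_family scale I (\<lambda>i. w' i s)}"
  proof (rule insert.IH)
    show "polynomial_curve scale (w' i)" if "i \<in> I" for i
      unfolding w'_def[abs_def]
      by (intro polynomial_curve_add polynomial_curve_scale insert.prems) (use that in auto)
    show "independent_family scale I (\<lambda>i. w' i s0)"
      unfolding independent_family_def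
    proof (intro allI impI ballI)
      fix \<alpha> i assume "(\<Sum>i\<in>I. \<alpha> i *s w' i s0) = 0" and i: "i \<in> I"
      from independent_familyD[OF insert.prems(2) this(1)[unfolded elim], of i] i insert.hyps
      show "\<alpha> i = 0" using q[of j s0] p(2) by (auto split: if_splits)
    qed
  qed
  moreover have "independent_family scale (insert j I) (\<lambda>i. w i s)"
    if ind: "independent_family scale I (\<lambda>i. w' i s)" and nz: "poly (q j) s \<noteq> 0" for s
    unfolding independent_family_def
  proof (intro allI impI)
    fix \<alpha> assume zero: "(\<Sum>i\<in>insert j I. \<alpha> i *s w i s) = 0"
    have "p (\<Sum>i\<in>insert j I. \<alpha> i *s w i s) = (\<Sum>i\<in>insert j I. \<alpha> i * poly (q i) s)"
      using q by (simp only: linear_formD[OF p(1)] cong: sum.cong)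
    then have form: "\<alpha> j * poly (q j) s = - (\<Sum>k\<in>I. \<alpha> k * poly (q k) s)"
      using zero linear_formD(2)[OF p(1), of 0] insert.hyps by (simp add: eq_neg_iff_add_eq_0)
    have "(\<Sum>i\<in>I. \<alpha> i *s w' i s) = poly (q j) s *s (\<Sum>i\<in>insert j I. \<alpha> i *s w i s)"
      unfolding elim scale_sum_right
      by (rule sum.cong) (auto simp: form[symmetric] mult.commute)
    then have "(\<Sum>i\<in>I. \<alpha> i *s w' i s) = 0" using zero by simp
    then have I: "\<alpha> i = 0" if "i \<in> I" for i using independent_familyD[OF ind] that by blast
    moreover have "\<alpha> j = 0" using form nz I by simp
    ultimately show "\<forall>i\<in>insert j I. \<alpha> i = 0" by blast
  qed
  then have "{s. \<not> independent_family scale (insert j I) (\<lambda>i. w i s)}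
      \<subseteq> {s. \<not> independent_family scale I (\<lambda>i. w' i s)} \<union> {s. poly (q j) s = 0}" by blast
  ultimately show ?case using poly_roots_finite[OF qj] by (meson finite_UnI finite_subset)
qed

lemma independent_family_image:
  assumes "finite I" "independent_family scale I w"
  shows "inj_on w I" "independent (w ` I)"
proof -
  show inj: "inj_on w I"
  proof (rule inj_onI, rule ccontr)
    fix i j assume ij: "i \<in> I" "j \<in> I" "w i = w j" "i \<noteq> j"
    have "(\<Sum>k\<in>I. ((if k = i then 1 else 0) - (if k = j then 1 else 0)) *s w k)
        = (\<Sum>k\<in>I. if k = i then w i else 0) - (\<Sum>k\<in>I. if k = j then w j else 0)"
      unfolding sum_subtractf[symmetric] by (rule sum.cong) auto
    also have "\<dots> = 0" using ij assms(1) by simp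
    finally show False using independent_familyD[OF assms(2) _ ij(1)] ij(4) by force
  qed
  show "independent (w ` I)"
    using assms inj unfolding dependent_finite[OF finite_imageI[OF assms(1)]]
    by (auto simp: sum.reindex dest: independent_familyD[OF assms(2)])
qed

text \<open>If \<open>v\<close> is a cyclic vector at one parameter, then finitely many powers give a basis there, and these
  remain linearly independent, hence a basis, for all but finitely many parameters.\<close>

lemma cyclic_vector_open:
  assumes fin: "finite C" "span C = UNIV"
    and G: "linear_map scale G" and H: "linear_map scale H"
    and cyc: "cyclic_vector scale (\<lambda>x. G x + s0 *s H x) v"
  shows "finite {s. \<not> cyclic_vector scale (\<lambda>x. G x + s *s H x) v}"
proof -
  define w where "w k s = ((\<lambda>x. G x + s *s H x) ^^ k) v" for k :: nat and s
  have curve: "polynomial_curve scale (w k)" for k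
  proof (induction k)
    case 0
    then show ?case using polynomial_curve_const[of v] by (simp add: w_def[abs_def])
  next
    case (Suc k)
    have "polynomial_curve scale (\<lambda>s. G (w k s) + poly [:0, 1:] s *s H (w k s))"
      by (intro polynomial_curve_add polynomial_curve_scale polynomial_curve_linear_map[OF Suc] G H)
    then show ?case by (simp add: w_def[abs_def])
  qed
  obtain B where B: "B \<subseteq> range (\<lambda>k. w k s0)" "independent B" "range (\<lambda>k. w k s0) \<subseteq> span B"
    using maximal_independent_subset[of "range (\<lambda>k. w k s0)"] by blast
  have spanB: "span B = UNIV"
    using cyc span_minimal[OF B(3) subspace_span] unfolding cyclic_vector_def w_def by auto
  have finB: "finite B" using independent_span_bound[OF fin(1) B(2)] fin(2) by auto
  interpret fd: finite_dimensional_vector_space scale B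
    by unfold_locales (use finB B(2) spanB in auto)
  obtain \<kappa> where \<kappa>: "\<And>b. b \<in> B \<Longrightarrow> b = w (\<kappa> b) s0" using B(1) by (metis imageE subsetD)
  have "independent_family scale B (\<lambda>b. b)"
    unfolding independent_family_def
    using B(2) dependent_finite[OF finB] by blast
  then have "independent_family scale B (\<lambda>b. w (\<kappa> b) s0)"
    unfolding independent_family_def using \<kappa> by (simp cong: sum.cong)
  then have "finite {s. \<not> independent_family scale B (\<lambda>b. w (\<kappa> b) s)}"
    by (rule independent_family_cofinite[OF finB curve])
  moreover have "cyclic_vector scale (\<lambda>x. G x + s *s H x) v"
    if ind: "independent_family scale B (\<lambda>b. w (\<kappa> b) s)" for s
  proof -
    let ?S = "(\<lambda>b. w (\<kappa> b) s) ` B"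
    have "card ?S = card B" by (rule card_image) (rule independent_family_image(1)[OF finB ind])
    then have "UNIV \<subseteq> span ?S"
      using independent_family_image(2)[OF finB ind] spanB
      by (intro fd.card_ge_dim_independent) (auto simp: fd.dim_UNIV fd.dimension_def)
    also have "\<dots> \<subseteq> span (range (\<lambda>k. w k s))" by (rule span_mono) auto
    finally show ?thesis unfolding cyclic_vector_def w_def by auto
  qed
  then have "{s. \<not> cyclic_vector scale (\<lambda>x. G x + s *s H x) v}
      \<subseteq> {s. \<not> independent_family scale B (\<lambda>b. w (\<kappa> b) s)}" by blast
  ultimately show ?thesis by (rule finite_subset[rotated])
qed

end

notation vector_scalar_mult (infixl "*s" 70)

section \<open>Values of multilinear polynomials as operators\<close>

text \<open>The value of \<open>f\<close> in an endomorphism ring, applied to a vector. Values in \<open>D\<close> and in two by two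
  matrices become comparable once both are read as operators.\<close>

definition op_value ::
    "('s :: zero \<Rightarrow> 'v \<Rightarrow> 'v) \<Rightarrow> 's ncpoly \<Rightarrow> (nat \<Rightarrow> 'v \<Rightarrow> 'v) \<Rightarrow> 'v \<Rightarrow> 'v :: ab_group_add" where
  "op_value smul f T x =
     (\<Sum>w\<in>Poly_Mapping.keys f. smul (Poly_Mapping.lookup f w) (foldr T w x))"

lemma division_ring_value_mult:
  "division_ring_value f c * x = op_value center_scale f (\<lambda>i x. c i * x) x"
proof -
  have "foldr (\<lambda>i. (*) (c i)) w 1 * x = foldr (\<lambda>i x. c i * x) w x" for w
    by (induction w) (simp_all add: mult.assoc)
  then show ?thesis
    unfolding division_ring_value_def ncpoly_value_def op_value_def sum_distrib_right
    by (simp add: center_scale_def mult.assoc)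
qed

lemma mat_mult_vector:
  fixes y :: "'b :: semiring_1 ^ 'n"
  shows "mat z *v y = z *s y"
  by (simp add: vec_eq_iff matrix_vector_mult_def mat_def if_distrib[of "\<lambda>t. t * _"] cong: if_cong)

lemma M2_value_mult:
  fixes f :: "'b :: field ncpoly"
  shows "M2_value f A *v x = op_value (*s) f (\<lambda>i. (*v) (A i)) x"
proof -
  have word: "foldr (\<lambda>i. (**) (A i)) w (mat 1) *v x = foldr (\<lambda>i. (*v) (A i)) w x" for w
    by (induction w) (simp_all add: matrix_vector_mul_assoc[symmetric])
  have "(mat z ** B) *v x = z *s (B *v x)" for z and B :: "'b ^ 2 ^ 2"
    by (simp add: matrix_vector_mul_assoc[symmetric] mat_mult_vector)
  moreover have "sum B W *v x = (\<Sum>w\<in>W. B w *v x)" for B :: "nat list \<Rightarrow> 'b ^ 2 ^ 2" and W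
    by (induction W rule: infinite_finite_induct) (simp_all add: matrix_vector_mult_add_rdistrib)
  ultimately show ?thesis
    by (simp add: M2_value_def ncpoly_value_def op_value_def word)
qed

lemma foldr_intertwine:
  assumes "\<And>i x. i \<in> set w \<Longrightarrow> h (S i x) = T i (h x)"
  shows "h (foldr S w x) = foldr T w (h x)"
  using assms by (induction w) auto

lemma op_value_intertwine:
  assumes "h 0 = 0" "\<And>x y. h (x + y) = h x + h y" "\<And>c x. h (smul c x) = smul' c (h x)"
    and "\<And>i x. h (S i x) = T i (h x)"
  shows "h (op_value smul f S x) = op_value smul' f T (h x)"
proof -
  have sum: "h (sum g W) = (\<Sum>w\<in>W. h (g w))" for g :: "nat list \<Rightarrow> _" and W
    by (induction W rule: infinite_finite_induct) (simp_all add: assms(1,2))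
  have "h (foldr S w x) = foldr T w (h x)" for w
    by (rule foldr_intertwine) (rule assms(4))
  then show ?thesis by (simp add: op_value_def sum assms(3))
qed

text \<open>Multilinearity in terms of the occurring words. In this form, splitting or scaling one argument can
  be treated word by word, without sums over permutations.\<close>

definition multilinear_words :: "nat \<Rightarrow> 'b :: zero ncpoly \<Rightarrow> bool" where
  "multilinear_words n f \<longleftrightarrow> (\<forall>w\<in>Poly_Mapping.keys f. distinct w \<and> set w = {1..n})"

lemma multilinear_imp_words:
  assumes "multilinear_ncpoly n f"
  shows "multilinear_words n f"
proof -
  obtain a where a: "f = (\<Sum>\<sigma> | \<sigma> permutes {1..n}. Poly_Mapping.single (map \<sigma> [1..<Suc n]) (a \<sigma>))"
    using assms unfolding multilinear_ncpoly_def by blast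
  have "distinct w \<and> set w = {1..n}" if w: "w \<in> Poly_Mapping.keys f" for w
  proof -
    have "Poly_Mapping.lookup f w
        = (\<Sum>\<sigma> | \<sigma> permutes {1..n}. Poly_Mapping.lookup (Poly_Mapping.single (map \<sigma> [1..<Suc n]) (a \<sigma>)) w)"
      unfolding a by (rule lookup_sum)
    moreover have "Poly_Mapping.lookup f w \<noteq> 0" using w by (simp add: in_keys_iff)
    ultimately obtain \<sigma> where \<sigma>: "\<sigma> permutes {1..n}"
        "Poly_Mapping.lookup (Poly_Mapping.single (map \<sigma> [1..<Suc n]) (a \<sigma>)) w \<noteq> 0"
      by (metis (mono_tags, lifting) mem_Collect_eq sum.neutral)
    then have "w = map \<sigma> [1..<Suc n]" by (simp add: lookup_single when_def split: if_splits)
    moreover have "set [1..<Suc n] = {1..n}" by auto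
    moreover have "inj_on \<sigma> {1..n}" "\<sigma> ` {1..n} = {1..n}"
      using permutes_inj_on[OF \<sigma>(1)] permutes_image[OF \<sigma>(1)] by auto
    ultimately show ?thesis by (simp add: distinct_map)
  qed
  then show ?thesis unfolding multilinear_words_def by blast
qed

lemma op_value_cong:
  assumes "multilinear_words n f" "\<And>i. i \<in> {1..n} \<Longrightarrow> S i = T i"
  shows "op_value smul f S x = op_value smul f T x"
  unfolding op_value_def
proof (rule sum.cong[OF refl])
  fix w assume "w \<in> Poly_Mapping.keys f"
  then have "set w = {1..n}" using assms(1) by (simp add: multilinear_words_def)
  then have "foldr S w x = foldr T w x" using assms(2) by (intro foldr_cong) auto
  then show "smul (Poly_Mapping.lookup f w) (foldr S w x) = smul (Poly_Mapping.lookup f w) (foldr T w x)"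
    by simp
qed

lemma foldr_upd_unused: "j \<notin> set w \<Longrightarrow> foldr (T(j := S)) w x = foldr T w x"
  by (induction w) auto

lemma op_value_add:
  assumes f: "multilinear_words n f" and j: "j \<in> {1..n}"
    and T: "\<And>i x y. T i (x + y) = T i x + T i y" and smul: "\<And>c x y. smul c (x + y) = smul c x + smul c y"
  shows "op_value smul f (T(j := (\<lambda>x. A x + B x))) x
    = op_value smul f (T(j := A)) x + op_value smul f (T(j := B)) x"
proof -
  have "foldr (T(j := (\<lambda>x. A x + B x))) w x = foldr (T(j := A)) w x + foldr (T(j := B)) w x"
    if "distinct w" "j \<in> set w" for w using that
  proof (induction w)
    case (Cons i w)
    then show ?case
      by (cases "i = j") (simp_all add: foldr_upd_unused T fun_upd_same fun_upd_other del: fun_upd_apply)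
  qed simp
  then show ?thesis
    using f j unfolding op_value_def sum.distrib[symmetric]
    by (intro sum.cong refl) (simp add: multilinear_words_def smul)
qed

lemma op_value_scale:
  assumes f: "multilinear_words n f" and j: "j \<in> {1..n}"
    and T: "\<And>i x. T i (h x) = h (T i x)" and smul: "\<And>c x. smul c (h x) = h (smul c x)"
    and h: "h 0 = 0" "\<And>x y. h (x + y) = h x + h y"
  shows "op_value smul f (T(j := (\<lambda>x. h (A x)))) x = h (op_value smul f (T(j := A)) x)"
proof -
  have sum: "h (sum g W) = (\<Sum>w\<in>W. h (g w))" for g :: "nat list \<Rightarrow> _" and W
    by (induction W rule: infinite_finite_induct) (simp_all add: h)
  have "foldr (T(j := (\<lambda>x. h (A x)))) w x = h (foldr (T(j := A)) w x)"
    if "distinct w" "j \<in> set w" for w using that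
  proof (induction w)
    case (Cons i w)
    then show ?case
      by (cases "i = j") (simp_all add: foldr_upd_unused T fun_upd_same fun_upd_other del: fun_upd_apply)
  qed simp
  then show ?thesis
    using f j unfolding op_value_def sum
    by (intro sum.cong refl) (simp add: multilinear_words_def smul)
qed

section \<open>An off-diagonal value in two by two matrices\<close>

lemma M2_value_cong:
  assumes "multilinear_words n f" "\<And>i. i \<in> {1..n} \<Longrightarrow> A i = B i"
  shows "M2_value f A = M2_value f B"
  unfolding matrix_eq M2_value_mult
  by (intro allI op_value_cong[OF assms(1)]) (simp add: assms(2))

lemma M2_value_add:
  assumes "multilinear_words n f" "j \<in> {1..n}"
  shows "M2_value f (A(j := X + Y)) = M2_value f (A(j := X)) + M2_value f (A(j := Y))"
proof -
  have upd: "(\<lambda>i. (*v) ((A(j := Z)) i)) = (\<lambda>i. (*v) (A i))(j := (*v) Z)" for Z by auto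
  have "(*v) (X + Y) = (\<lambda>x. X *v x + Y *v x)" by (simp add: fun_eq_iff matrix_vector_mult_add_rdistrib)
  then show ?thesis
    unfolding matrix_eq matrix_vector_mult_add_rdistrib M2_value_mult upd
    using op_value_add[OF assms, of "\<lambda>i. (*v) (A i)" "(*s)" "(*v) X" "(*v) Y"]
    by (simp add: matrix_vector_right_distrib vector_add_ldistrib)
qed

lemma M2_value_scale:
  fixes f :: "'b :: field ncpoly"
  assumes "multilinear_words n f" "j \<in> {1..n}"
  shows "M2_value f (A(j := mat z ** X)) = mat z ** M2_value f (A(j := X))"
proof -
  have upd: "(\<lambda>i. (*v) ((A(j := Z)) i)) = (\<lambda>i. (*v) (A i))(j := (*v) Z)" for Z by auto
  have "(*v) (mat z ** X) = (\<lambda>x. z *s (X *v x))"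
    by (simp add: fun_eq_iff matrix_vector_mul_assoc[symmetric] mat_mult_vector)
  then show ?thesis
    unfolding matrix_eq matrix_vector_mul_assoc[symmetric] M2_value_mult upd mat_mult_vector
    using op_value_scale[OF assms, of "\<lambda>i. (*v) (A i)" "(*s) z" "(*s)" "(*v) X"]
    by (simp add: vector_scalar_commute vector_smult_assoc mult.commute vector_add_ldistrib)
qed

lemma M2_value_conjugate:
  assumes "P ** P' = mat 1" "P' ** P = mat 1"
  shows "M2_value f (\<lambda>i. P ** A i ** P') = P ** M2_value f A ** P'"
proof -
  have "M2_value f (\<lambda>i. P ** A i ** P') *v (P *v y) = P *v (M2_value f A *v y)" for y
    unfolding M2_value_mult
    by (rule op_value_intertwine[symmetric])
      (simp_all add: matrix_vector_right_distrib vector_scalar_commute matrix_vector_mul_assoc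
        matrix_mul_assoc[symmetric] assms)
  from this[of "P' *v y" for y] show ?thesis
    unfolding matrix_eq by (simp add: matrix_vector_mul_assoc matrix_mul_assoc assms)
qed

text \<open>The grading of the two by two matrices by \<open>\<int>/2\<close>: diagonal matrices have degree 0, matrices with
  zero diagonal have degree 1. Since every word contains each variable once, all words have the
  same degree, and the value of \<open>f\<close> at homogeneous arguments is homogeneous.\<close>

definition homogeneous :: "bool \<Rightarrow> 'b :: zero ^ 2 ^ 2 \<Rightarrow> bool" where
  "homogeneous d X \<longleftrightarrow> (if d then X $ 1 $ 1 = 0 \<and> X $ 2 $ 2 = 0 else X $ 1 $ 2 = 0 \<and> X $ 2 $ 1 = 0)"

lemma matrix_mult_2:
  fixes X Y :: "'b :: semiring_1 ^ 2 ^ 2"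
  shows "(X ** Y) $ i $ j = X $ i $ 1 * Y $ 1 $ j + X $ i $ 2 * Y $ 2 $ j"
  by (simp add: matrix_matrix_mult_def sum_2)

lemma homogeneous_mult:
  fixes X Y :: "'b :: semiring_1 ^ 2 ^ 2"
  shows "homogeneous d X \<Longrightarrow> homogeneous e Y \<Longrightarrow> homogeneous (d \<noteq> e) (X ** Y)"
  by (auto simp: homogeneous_def matrix_mult_2 split: if_splits)

lemma M2_value_homogeneous:
  fixes f :: "'b :: field ncpoly"
  assumes f: "multilinear_words n f" and A: "\<And>i. i \<in> {1..n} \<Longrightarrow> homogeneous (d i) (A i)"
  shows "homogeneous (odd (card {i \<in> {1..n}. d i})) (M2_value f A)"
proof -
  have word: "homogeneous (odd (card {i \<in> set w. d i})) (foldr (\<lambda>i. (**) (A i)) w (mat 1))"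
    if "distinct w" "set w \<subseteq> {1..n}" for w using that
  proof (induction w)
    case Nil
    then show ?case by (simp add: homogeneous_def mat_def)
  next
    case (Cons i w)
    have "{k \<in> set (i # w). d k} = (if d i then insert i {k \<in> set w. d k} else {k \<in> set w. d k})" by auto
    then have "odd (card {k \<in> set (i # w). d k}) = (d i \<noteq> odd (card {k \<in> set w. d k}))"
      using Cons.prems(1) by auto
    then show ?case using homogeneous_mult[OF A Cons.IH, of i] Cons.prems by simp
  qed
  have scale: "homogeneous e (mat z ** X)" if "homogeneous e X" for e z and X :: "'b ^ 2 ^ 2"
    using homogeneous_mult[of False "mat z" e X] that by (simp add: homogeneous_def mat_def)
  have sum: "homogeneous e (sum X W)" if "\<And>w. w \<in> W \<Longrightarrow> homogeneous e (X w)"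
    for e and X :: "nat list \<Rightarrow> 'b ^ 2 ^ 2" and W using that
    by (induction W rule: infinite_finite_induct) (auto simp: homogeneous_def split: if_splits)
  show ?thesis
    unfolding M2_value_def ncpoly_value_def
  proof (intro sum scale)
    fix w assume "w \<in> Poly_Mapping.keys f"
    then have "distinct w" "set w = {1..n}" using f by (auto simp: multilinear_words_def)
    then show "homogeneous (odd (card {i \<in> {1..n}. d i})) (foldr (\<lambda>i. (**) (A i)) w (mat 1))"
      using word[of w] by simp
  qed
qed

definition mat2 :: "'b \<Rightarrow> 'b \<Rightarrow> 'b \<Rightarrow> 'b \<Rightarrow> 'b ^ 2 ^ 2" where
  "mat2 a b c d = (\<chi> i j. if i = 1 then (if j = 1 then a else b) else (if j = 1 then c else d))"

lemma mat2_nth [simp]: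
  "mat2 a b c d $ 1 $ 1 = a" "mat2 a b c d $ 1 $ 2 = b" "mat2 a b c d $ 2 $ 1 = c" "mat2 a b c d $ 2 $ 2 = d"
  by (simp_all add: mat2_def)

lemma mat2_eq_iff: "(X :: 'b ^ 2 ^ 2) = Y \<longleftrightarrow>
    X $ 1 $ 1 = Y $ 1 $ 1 \<and> X $ 1 $ 2 = Y $ 1 $ 2 \<and> X $ 2 $ 1 = Y $ 2 $ 1 \<and> X $ 2 $ 2 = Y $ 2 $ 2"
  by (auto simp: vec_eq_iff forall_2)

lemma mat_nth_2 [simp]:
  "mat z $ (1 :: 2) $ 1 = z" "mat z $ (1 :: 2) $ 2 = 0" "mat z $ (2 :: 2) $ 1 = 0" "mat z $ (2 :: 2) $ 2 = z"
  by (simp_all add: mat_def)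

text \<open>If all values were diagonal, conjugating them by a transvection would show that they are scalar.\<close>

lemma noncentral_off_diagonal:
  fixes f :: "'b :: field ncpoly"
  assumes "noncentral_over_M2 f"
  shows "\<exists>A. M2_value f A $ 1 $ 2 \<noteq> 0 \<or> M2_value f A $ 2 $ 1 \<noteq> 0"
proof (rule ccontr)
  assume "\<not> ?thesis"
  then have diag: "M2_value f A $ 1 $ 2 = 0" "M2_value f A $ 2 $ 1 = 0" for A by auto
  have "M2_value f A ** B = B ** M2_value f A" for A B
  proof -
    \<comment> \<open>the upper right entry of the conjugate is the difference of the diagonal entries\<close>
    let ?U = "mat2 1 1 0 1 :: 'b ^ 2 ^ 2" and ?V = "mat2 1 (- 1) 0 1 :: 'b ^ 2 ^ 2"
    have "M2_value f (\<lambda>i. ?U ** A i ** ?V) = ?U ** M2_value f A ** ?V"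
      by (rule M2_value_conjugate) (simp_all add: mat2_eq_iff matrix_mult_2)
    then have "(?U ** M2_value f A ** ?V) $ 1 $ 2 = 0" using diag by metis
    then have "M2_value f A $ 1 $ 1 = M2_value f A $ 2 $ 2" by (simp add: matrix_mult_2 diag)
    then show ?thesis by (simp add: mat2_eq_iff matrix_mult_2 diag mult.commute)
  qed
  then show False using assms unfolding noncentral_over_M2_def by blast
qed

text \<open>By multilinearity the arguments can be split into their homogeneous parts one after the other while
  keeping a nonzero off-diagonal entry. This entry shows that the value, then homogeneous, has
  degree 1.\<close>

lemma noncentral_homogeneous:
  fixes f :: "'b :: field ncpoly"
  assumes f: "multilinear_words n f" and "noncentral_over_M2 f"
  shows "\<exists>d A. (\<forall>i. homogeneous (d i) (A i)) \<and> odd (card {i \<in> {1..n}. d i}) \<and> M2_value f A $ 1 $ 2 \<noteq> 0"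
proof -
  obtain A0 where "M2_value f A0 $ 1 $ 2 \<noteq> 0 \<or> M2_value f A0 $ 2 $ 1 \<noteq> 0"
    using noncentral_off_diagonal[OF assms(2)] by blast
  then obtain A1 where A1: "M2_value f A1 $ 1 $ 2 \<noteq> 0"
  proof
    assume *: "M2_value f A0 $ 2 $ 1 \<noteq> 0"
    let ?J = "mat2 0 1 1 0 :: 'b ^ 2 ^ 2"
    have "M2_value f (\<lambda>i. ?J ** A0 i ** ?J) = ?J ** M2_value f A0 ** ?J"
      by (rule M2_value_conjugate) (simp_all add: mat2_eq_iff matrix_mult_2)
    then have "M2_value f (\<lambda>i. ?J ** A0 i ** ?J) $ 1 $ 2 = M2_value f A0 $ 2 $ 1"
      by (simp add: matrix_mult_2)
    then show thesis using that * by metis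
  qed
  have "\<exists>A. (\<forall>i\<in>{1..k}. \<exists>d. homogeneous d (A i)) \<and> M2_value f A $ 1 $ 2 \<noteq> 0" if "k \<le> n" for k using that
  proof (induction k)
    case 0
    then show ?case using A1 by auto
  next
    case (Suc k)
    then obtain A where A: "\<forall>i\<in>{1..k}. \<exists>d. homogeneous d (A i)" "M2_value f A $ 1 $ 2 \<noteq> 0" by auto
    let ?j = "Suc k"
    let ?X = "mat2 (A ?j $ 1 $ 1) 0 0 (A ?j $ 2 $ 2)" and ?Y = "mat2 0 (A ?j $ 1 $ 2) (A ?j $ 2 $ 1) 0"
    have "A ?j = ?X + ?Y" by (simp add: mat2_eq_iff)
    then have "M2_value f A = M2_value f (A(?j := ?X)) + M2_value f (A(?j := ?Y))"
      using M2_value_add[OF f, of ?j A ?X ?Y] Suc.prems by (metis atLeastAtMost_iff fun_upd_triv le_add1 plus_1_eq_Suc)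
    then have "M2_value f (A(?j := ?X)) $ 1 $ 2 \<noteq> 0 \<or> M2_value f (A(?j := ?Y)) $ 1 $ 2 \<noteq> 0"
      using A(2) by auto
    moreover have "homogeneous False ?X" "homogeneous True ?Y" by (simp_all add: homogeneous_def)
    ultimately obtain Z d where Z: "homogeneous d Z" "M2_value f (A(?j := Z)) $ 1 $ 2 \<noteq> 0" by blast
    have "\<exists>d. homogeneous d ((A(?j := Z)) i)" if "i \<in> {1..?j}" for i
      using that A(1) Z(1) by (cases "i = ?j") auto
    then show ?case using Z(2) by blast
  qed
  then obtain A where A: "\<forall>i\<in>{1..n}. \<exists>d. homogeneous d (A i)" "M2_value f A $ 1 $ 2 \<noteq> 0" by blast
  obtain d where d: "\<And>i. i \<in> {1..n} \<Longrightarrow> homogeneous (d i) (A i)" using A(1) by metis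
  define B where "B i = (if i \<in> {1..n} then A i else 0)" for i
  have "M2_value f B = M2_value f A" by (rule M2_value_cong[OF f]) (simp add: B_def)
  then have "M2_value f B $ 1 $ 2 \<noteq> 0" using A(2) by simp
  moreover have "homogeneous (d i) (B i)" for i using d[of i] by (auto simp: B_def homogeneous_def)
  moreover have "odd (card {i \<in> {1..n}. d i})"
  proof (rule ccontr)
    define t where "t = odd (card {i \<in> {1..n}. d i})"
    have "homogeneous t (M2_value f A)"
      unfolding t_def by (rule M2_value_homogeneous[OF f d])
    moreover assume "\<not> ?thesis"
    then have "\<not> t" unfolding t_def .
    ultimately have "homogeneous False (M2_value f A)" by simp
    then show False using A(2) by (simp add: homogeneous_def)
  qed
  ultimately show ?thesis by blast
qed

text \<open>Exchanging the two basis vectors exchanges the two off-diagonal entries of the value without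
  changing degrees. One argument after the other, arguments giving a nonzero upper and those
  giving a nonzero lower entry are merged into generic linear combinations.\<close>

lemma noncentral_generic_value:
  fixes f :: "'b :: field ncpoly"
  assumes f: "multilinear_words n f" and "noncentral_over_M2 f" and inf: "infinite (UNIV :: 'b set)"
  shows "1 \<le> n \<and> (\<exists>A p q. p \<noteq> 0 \<and> q \<noteq> 0 \<and> M2_value f A = mat2 0 p q 0)"
proof -
  obtain d A where A: "\<forall>i. homogeneous (d i) (A i)" and odd: "odd (card {i \<in> {1..n}. d i})"
    and A12: "M2_value f A $ 1 $ 2 \<noteq> 0"
    using noncentral_homogeneous[OF assms(1,2)] by blast
  have n: "1 \<le> n"
  proof (rule ccontr)
    assume "\<not> 1 \<le> n"
    then have "{i \<in> {1..n}. d i} = {}" by auto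
    then have none: "card {i \<in> {1..n}. d i} = 0" by (simp only: card.empty)
    from odd[unfolded none] show False by simp
  qed
  let ?J = "mat2 0 1 1 0 :: 'b ^ 2 ^ 2"
  define A' where "A' i = ?J ** A i ** ?J" for i
  have "M2_value f A' = ?J ** M2_value f A ** ?J"
    unfolding A'_def by (rule M2_value_conjugate) (simp_all add: mat2_eq_iff matrix_mult_2)
  then have A21: "M2_value f A' $ 2 $ 1 \<noteq> 0" using A12 by (simp add: matrix_mult_2)
  have A': "\<forall>i. homogeneous (d i) (A' i)"
    using A by (auto simp: A'_def homogeneous_def matrix_mult_2 split: if_splits)
  have "\<exists>B. (\<forall>i. homogeneous (d i) (B i)) \<and> M2_value f B $ 1 $ 2 \<noteq> 0 \<and> M2_value f B $ 2 $ 1 \<noteq> 0"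
    if "finite K" "K \<subseteq> {1..n}" "\<forall>i. homogeneous (d i) (A i)" "\<forall>i. homogeneous (d i) (A' i)"
      "M2_value f A $ 1 $ 2 \<noteq> 0" "M2_value f A' $ 2 $ 1 \<noteq> 0" "\<And>i. i \<in> {1..n} - K \<Longrightarrow> A i = A' i" for K A A'
    using that
  proof (induction K arbitrary: A A' rule: finite_induct)
    case empty
    have "M2_value f A = M2_value f A'" by (rule M2_value_cong[OF f]) (use empty in auto)
    then show ?case using empty by auto
  next
    case (insert j K)
    have j: "j \<in> {1..n}" using insert.prems by auto
    define X where "X s = A j + mat s ** A' j" for s
    have lin: "M2_value f (C(j := X s)) $ k $ l
        = M2_value f (C(j := A j)) $ k $ l + s * M2_value f (C(j := A' j)) $ k $ l" for C s k l
    proof -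
      have "M2_value f (C(j := X s)) = M2_value f (C(j := A j)) + mat s ** M2_value f (C(j := A' j))"
        unfolding X_def M2_value_add[OF f j] M2_value_scale[OF f j] ..
      moreover have "(mat s ** Y) $ k $ l = s * Y $ k $ l" for Y
        using exhaust_2[of k] by (auto simp: matrix_mult_2)
      ultimately show ?thesis by simp
    qed
    have fin: "finite {s :: 'b. a + s * b = 0}" if "a \<noteq> 0 \<or> b \<noteq> 0" for a b
    proof (cases "b = 0")
      case False
      have "{s. a + s * b = 0} \<subseteq> {- a / b}" using False by (auto simp: field_simps eq_neg_iff_add_eq_0)
      then show ?thesis by (rule finite_subset) simp
    qed (use that in simp)
    have "finite ({s. M2_value f (A(j := X s)) $ 1 $ 2 = 0} \<union> {s. M2_value f (A'(j := X s)) $ 2 $ 1 = 0})"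
      unfolding lin using insert.prems by (intro finite_UnI fin) auto
    from ex_new_if_finite[OF inf this]
    obtain s where s: "M2_value f (A(j := X s)) $ 1 $ 2 \<noteq> 0" "M2_value f (A'(j := X s)) $ 2 $ 1 \<noteq> 0"
      by auto
    have "homogeneous (d j) (X s)"
    proof -
      have "homogeneous (d j) (A j)" "homogeneous (d j) (A' j)" using insert.prems by auto
      then show ?thesis by (auto simp: X_def homogeneous_def matrix_mult_2 split: if_splits)
    qed
    then have "\<forall>i. homogeneous (d i) ((A(j := X s)) i)" "\<forall>i. homogeneous (d i) ((A'(j := X s)) i)"
      using insert.prems(2,3) by auto
    moreover have "(A(j := X s)) i = (A'(j := X s)) i" if "i \<in> {1..n} - K" for i
      using insert.prems(6)[of i] that by auto
    ultimately show ?case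
      using insert.IH[of "A(j := X s)" "A'(j := X s)"] insert.prems(1) s by blast
  qed
  from this[of "{1..n}" A A'] obtain B where B: "\<forall>i. homogeneous (d i) (B i)"
    "M2_value f B $ 1 $ 2 \<noteq> 0" "M2_value f B $ 2 $ 1 \<noteq> 0" using A A' A12 A21 by auto
  define t where "t = odd (card {i \<in> {1..n}. d i})"
  have "homogeneous t (M2_value f B)"
    unfolding t_def by (rule M2_value_homogeneous[OF f]) (use B(1) in blast)
  moreover have t using odd unfolding t_def .
  ultimately have "homogeneous True (M2_value f B)" by simp
  then have "M2_value f B = mat2 0 (M2_value f B $ 1 $ 2) (M2_value f B $ 2 $ 1) 0"
    by (simp add: homogeneous_def mat2_eq_iff)
  then show ?thesis using B n by blast
qed

section \<open>\<open>D\<close> as a right vector space over a self-centralizing subfield\<close>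

definition right_scale :: "'a maxfield \<Rightarrow> 'a \<Rightarrow> 'a :: division_ring" where
  "right_scale l x = x * of_maxfield l"

interpretation R: vector_space "right_scale :: 'a maxfield \<Rightarrow> 'a \<Rightarrow> 'a :: division_ring"
proof
  fix k l :: "'a maxfield" and x y :: 'a
  have "of_maxfield k * of_maxfield l = of_maxfield l * of_maxfield k"
    by (simp add: of_maxfield_hom[symmetric] mult.commute)
  then show "right_scale k (right_scale l x) = right_scale (k * l) x"
    by (simp add: right_scale_def of_maxfield_hom mult.assoc)
qed (simp_all add: right_scale_def of_maxfield_hom distrib_left distrib_right)

definition maxfield_of_center :: "'a :: division_ring center \<Rightarrow> 'a maxfield" where
  "maxfield_of_center z = Abs_maxfield (of_center z)"

lemma of_maxfield_of_center [simp]: "of_maxfield (maxfield_of_center z) = of_center z"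
  by (simp add: maxfield_of_center_def Abs_maxfield_inverse chosen_subfield_closed)

lemma maxfield_of_center_inject: "maxfield_of_center z = maxfield_of_center z' \<longleftrightarrow> z = z'"
  by (metis of_maxfield_of_center of_center_inject)

lemma right_scale_center_scale: "right_scale l (center_scale z x) = center_scale z (right_scale l x)"
  by (simp add: right_scale_def center_scale_def mult.assoc)

lemma bimult_linear_map: "\<phi> \<in> bimult chosen_subfield \<Longrightarrow> linear_map right_scale \<phi>"
  unfolding linear_map_def right_scale_def
  by (intro conjI allI bimult_additive
      bimult_linear[OF centralizer_chosen_subfield of_maxfield]) assumption+

lemma mult_left_bimult: "(\<lambda>x. c * x) \<in> bimult chosen_subfield"
  using bimult.mult[of 1 chosen_subfield c] by (simp add: chosen_subfield_closed)

lemma right_independentI: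
  assumes "R.independent B"
  shows "right_independent chosen_subfield B"
  unfolding right_independent_def
proof (intro ballI notI, elim exE conjE)
  fix b g assume b: "b \<in> B" and g: "\<forall>c\<in>B - {b}. g c \<in> chosen_subfield" "b = (\<Sum>c\<in>B - {b}. c * g c)"
  have "(\<Sum>c\<in>B - {b}. c * g c) \<in> R.span (B - {b})"
  proof (rule R.span_sum)
    fix c assume c: "c \<in> B - {b}"
    then have "c * g c = right_scale (Abs_maxfield (g c)) c"
      using g(1) by (simp add: right_scale_def Abs_maxfield_inverse)
    then show "c * g c \<in> R.span (B - {b})" using c by (simp add: R.span_scale R.span_base)
  qed
  then show False using assms b g(2) unfolding R.dependent_def by metis
qed

lemma op_value_linear_map:
  assumes T: "\<And>i. linear_map right_scale (T i)"
  shows "linear_map right_scale (op_value center_scale f T)"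
  unfolding linear_map_def
proof (intro conjI allI)
  fix x y l
  have "foldr T w (x + y) = foldr T w x + foldr T w y" for w
    by (induction w) (simp_all add: R.linear_mapD[OF T])
  then show "op_value center_scale f T (x + y) = op_value center_scale f T x + op_value center_scale f T y"
    by (simp add: op_value_def sum.distrib D.scale_right_distrib)
  show "op_value center_scale f T (right_scale l x) = right_scale l (op_value center_scale f T x)"
    by (rule op_value_intertwine[symmetric])
      (simp_all add: R.linear_mapD[OF T] R.scale_right_distrib right_scale_center_scale)
qed

text \<open>Replacing right factors by central ones. Let \<open>\<lambda>\<^sub>d\<close> and \<open>\<rho>\<^sub>s\<close> be the left and right
  multiplications. Along \<open>s \<mapsto> \<psi> + \<lambda>\<^sub>d \<rho>\<^sub>s\<close> the value of \<open>f\<close> is affine in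
  \<open>s\<close>, so cyclicity persists for almost all \<open>s\<close>, in particular for some central
  one, for which \<open>\<lambda>\<^sub>d \<rho>\<^sub>s\<close> is a left multiplication. The summands of \<open>\<phi>\<close> are treated one at a
  time, which is why another operator \<open>\<psi>\<close> is carried along.\<close>

lemma replace_operator:
  fixes f :: "'a :: division_ring center ncpoly"
  assumes f: "multilinear_words n f" and j: "j \<in> {1..n}" and inf: "infinite (UNIV :: 'a center set)"
    and fin: "finite C" "R.span C = (UNIV :: 'a set)" and T: "\<And>i. linear_map right_scale (T i)"
  shows "\<phi> \<in> bimult chosen_subfield \<Longrightarrow> linear_map right_scale \<psi> \<Longrightarrow>
    cyclic_vector right_scale (op_value center_scale f (T(j := (\<lambda>x. \<psi> x + \<phi> x)))) v \<Longrightarrow>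
    \<exists>c. cyclic_vector right_scale (op_value center_scale f (T(j := (\<lambda>x. \<psi> x + c * x)))) v"
proof (induction arbitrary: \<psi> rule: bimult.induct)
  case (mult l d)
  define G where "G = op_value center_scale f (T(j := \<psi>))"
  define H where "H = op_value center_scale f (T(j := (\<lambda>x. d * x)))"
  have lin: "linear_map right_scale G" "linear_map right_scale H"
    unfolding G_def H_def
    by (rule op_value_linear_map; use T mult.prems(1) bimult_linear_map[OF mult_left_bimult[of d]] in simp)+
  have val: "op_value center_scale f (T(j := (\<lambda>x. \<psi> x + right_scale s (d * x)))) = (\<lambda>x. G x + right_scale s (H x))" for s
  proof
    fix x
    show "op_value center_scale f (T(j := (\<lambda>x. \<psi> x + right_scale s (d * x)))) x = G x + right_scale s (H x)"
      unfolding G_def H_def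
      by (subst op_value_add[OF f j], simp add: R.linear_mapD[OF T], simp add: D.scale_right_distrib,
        subst op_value_scale[OF f j, of T "right_scale s"])
        (simp_all add: R.linear_mapD[OF T] R.scale_right_distrib right_scale_center_scale)
  qed
  have l: "right_scale (Abs_maxfield l) (d * x) = d * x * l" for x
    using mult.hyps by (simp add: right_scale_def Abs_maxfield_inverse)
  have "cyclic_vector right_scale (\<lambda>x. G x + right_scale (Abs_maxfield l) (H x)) v"
    using mult.prems(2) unfolding val[symmetric] l .
  then have bad: "finite {s. \<not> cyclic_vector right_scale (\<lambda>x. G x + right_scale s (H x)) v}"
    by (rule R.cyclic_vector_open[OF fin lin])
  have "inj (maxfield_of_center :: 'a center \<Rightarrow> _)"
    by (rule injI) (simp add: maxfield_of_center_inject)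
  then have "infinite (range (maxfield_of_center :: 'a center \<Rightarrow> _))"
    using inf finite_imageD by blast
  then have "\<not> range maxfield_of_center \<subseteq> {s. \<not> cyclic_vector right_scale (\<lambda>x. G x + right_scale s (H x)) v}"
    using finite_subset[OF _ bad] by blast
  then obtain z :: "'a center" where
    "cyclic_vector right_scale (\<lambda>x. G x + right_scale (maxfield_of_center z) (H x)) v"
    by blast
  then have "cyclic_vector right_scale
      (op_value center_scale f (T(j := (\<lambda>x. \<psi> x + right_scale (maxfield_of_center z) (d * x))))) v"
    unfolding val .
  moreover have "right_scale (maxfield_of_center z) (d * x) = (of_center z * d) * x" for x
    by (simp add: right_scale_def of_center_commute mult.assoc)
  ultimately have "cyclic_vector right_scale
      (op_value center_scale f (T(j := (\<lambda>x. \<psi> x + (of_center z * d) * x)))) v"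
    by (simp only:)
  then show ?case by blast
next
  case (add \<phi> \<phi>')
  have lin: "linear_map right_scale (\<lambda>x. \<psi> x + \<phi> x)"
    using add.prems(1) bimult_linear_map[OF add.hyps(1)]
    by (simp add: linear_map_def R.scale_right_distrib)
  have "\<exists>c. cyclic_vector right_scale (op_value center_scale f (T(j := (\<lambda>x. (\<psi> x + \<phi> x) + c * x)))) v"
    by (rule add.IH(2)[OF lin]) (use add.prems(2) in \<open>simp add: add.assoc\<close>)
  then obtain c where
    c: "cyclic_vector right_scale (op_value center_scale f (T(j := (\<lambda>x. (\<psi> x + \<phi> x) + c * x)))) v" ..
  have lin': "linear_map right_scale (\<lambda>x. \<psi> x + c * x)"
    using add.prems(1) bimult_linear_map[OF mult_left_bimult[of c]]
    by (simp add: linear_map_def R.scale_right_distrib)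
  have swap: "(\<lambda>x. (\<psi> x + \<phi> x) + c * x) = (\<lambda>x. (\<psi> x + c * x) + \<phi> x)" by (simp add: ac_simps)
  from add.IH(1)[OF lin' c[unfolded swap]] obtain c' where "cyclic_vector right_scale
      (op_value center_scale f (T(j := (\<lambda>x. (\<psi> x + c * x) + c' * x)))) v"
    ..
  then have "cyclic_vector right_scale (op_value center_scale f (T(j := (\<lambda>x. \<psi> x + (c + c') * x)))) v"
    by (simp add: distrib_right add.assoc)
  then show ?case by blast
qed

lemma replace_operators:
  fixes f :: "'a :: division_ring center ncpoly"
  assumes f: "multilinear_words n f" and inf: "infinite (UNIV :: 'a center set)"
    and fin: "finite C" "R.span C = (UNIV :: 'a set)" and T: "\<And>i. T i \<in> bimult chosen_subfield"
    and cyc: "cyclic_vector right_scale (op_value center_scale f T) v"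
  shows "\<exists>c. cyclic_vector right_scale (\<lambda>x. division_ring_value f c * x) v"
proof -
  have "\<exists>T. (\<forall>i. T i \<in> bimult chosen_subfield) \<and> (\<forall>i\<in>{1..k}. \<exists>c. T i = (\<lambda>x. c * x)) \<and>
      cyclic_vector right_scale (op_value center_scale f T) v" if "k \<le> n" for k using that
  proof (induction k)
    case 0
    then show ?case using T cyc by auto
  next
    case (Suc k)
    then obtain T where T: "\<And>i. T i \<in> bimult chosen_subfield" "\<forall>i\<in>{1..k}. \<exists>c. T i = (\<lambda>x. c * x)"
      and cyc: "cyclic_vector right_scale (op_value center_scale f T) v" by auto
    have "\<exists>c. cyclic_vector right_scale (op_value center_scale f (T(Suc k := (\<lambda>x. 0 + c * x)))) v"
    proof (rule replace_operator[OF f _ inf fin bimult_linear_map[OF T(1)] T(1)[of "Suc k"]])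
      show "linear_map right_scale (\<lambda>x :: 'a. 0)" by (simp add: linear_map_def)
      show "cyclic_vector right_scale (op_value center_scale f (T(Suc k := (\<lambda>x. 0 + T (Suc k) x)))) v"
        using cyc by (simp add: fun_upd_idem)
    qed (use Suc.prems in auto)
    then obtain c where
      c: "cyclic_vector right_scale (op_value center_scale f (T(Suc k := (\<lambda>x. c * x)))) v" by auto
    have "\<forall>i. (T(Suc k := (\<lambda>x. c * x))) i \<in> bimult chosen_subfield"
      using T(1) mult_left_bimult by simp
    moreover have "\<forall>i\<in>{1..Suc k}. \<exists>c'. (T(Suc k := (\<lambda>x. c * x))) i = (\<lambda>x. c' * x)"
      using T(2) by (auto simp: le_Suc_eq)
    ultimately show ?case using c by blast
  qed
  then obtain T where T: "\<forall>i\<in>{1..n}. \<exists>c. T i = (\<lambda>x. c * x)"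
    and cyc: "cyclic_vector right_scale (op_value center_scale f T) v" by blast
  obtain c where c: "\<And>i. i \<in> {1..n} \<Longrightarrow> T i = (\<lambda>x. c i * x)" using T by metis
  have "op_value center_scale f T = (\<lambda>x. division_ring_value f c * x)"
    unfolding division_ring_value_mult by (intro ext op_value_cong[OF f] c)
  then show ?thesis using cyc by auto
qed

text \<open>An element \<open>b\<close> commuting with \<open>a\<close> satisfies \<open>b * v = (\<Sum>k. a ^ k * v * l\<^sub>k)\<close> with suitable \<open>l\<^sub>k \<in> L\<close>. The
  same identity then holds with any \<open>x\<close> in place of \<open>v\<close>: both sides are right linear in \<open>x\<close> and
  commute with left multiplication by \<open>a\<close>, hence agree on the spanning elements \<open>a ^ k * v\<close>. By
  \<open>two_sided_dependence\<close>, \<open>b\<close> is a polynomial in \<open>a\<close> over the center.\<close>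

lemma cyclic_vector_imp_maximal:
  fixes a v :: "'a :: division_ring"
  assumes cyc: "cyclic_vector right_scale (\<lambda>x. a * x) v"
  shows "maximal_comm_subfield (center_adjoin a)"
proof -
  let ?K = "center_adjoin a"
  have K: "comm_subfield ?K" by (rule comm_subfield_center_adjoin)
  have sub: "insert a (range of_center) \<subseteq> ?K" unfolding center_adjoin_def by (rule hull_subset)
  have Kz: "of_center z \<in> ?K" for z using sub by blast
  have K0: "0 \<in> ?K" using sub zero_center.rep_eq by (metis insert_subset rangeI subsetD)
  have Kmult: "x * y \<in> ?K" if "x \<in> ?K" "y \<in> ?K" for x y using K that by (simp add: comm_subfield_def)
  have Kadd: "x + y \<in> ?K" if "x \<in> ?K" "y \<in> ?K" for x y
  proof -
    have "0 - y \<in> ?K" using K that K0 unfolding comm_subfield_def by blast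
    then have "x - (0 - y) \<in> ?K" using K that(1) unfolding comm_subfield_def by blast
    then show ?thesis by simp
  qed
  have Kpow: "a ^ k \<in> ?K" for k
  proof (induction k)
    case 0
    then show ?case using K by (simp add: comm_subfield_def)
  next
    case (Suc k)
    then show ?case using Kmult[of a "a ^ k"] sub by simp
  qed
  have pow: "((\<lambda>x. a * x) ^^ k) v = a ^ k * v" for k
    by (induction k) (simp_all add: mult.assoc)
  let ?P = "range (\<lambda>k. a ^ k * v)"
  have span: "R.span ?P = UNIV" using cyc by (simp add: cyclic_vector_def pow)
  have "b \<in> ?K" if b: "b * a = a * b" for b
  proof -
    have "b * v \<in> R.span ?P" using span by simp
    then obtain t r where t: "finite t" "t \<subseteq> ?P" "b * v = (\<Sum>u\<in>t. right_scale (r u) u)"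
      unfolding R.span_explicit by auto
    have "\<forall>u\<in>t. \<exists>k. u = a ^ k * v" using t(2) by blast
    then obtain \<kappa> where \<kappa>: "\<And>u. u \<in> t \<Longrightarrow> u = a ^ \<kappa> u * v" by metis
    have "\<forall>x\<in>R.span ?P. b * x = (\<Sum>u\<in>t. a ^ \<kappa> u * x * of_maxfield (r u))"
    proof (intro ballI, erule R.span_induct)
      show "R.subspace {x. b * x = (\<Sum>u\<in>t. a ^ \<kappa> u * x * of_maxfield (r u))}"
      proof (rule R.subspaceI)
        fix l :: "'a maxfield" and x assume x: "x \<in> {x. b * x = (\<Sum>u\<in>t. a ^ \<kappa> u * x * of_maxfield (r u))}"
        have comm: "of_maxfield k * of_maxfield l = of_maxfield l * of_maxfield k" for k
          by (simp add: of_maxfield_hom[symmetric] mult.commute)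
        have "b * (x * of_maxfield l) = b * x * of_maxfield l" by (simp add: mult.assoc)
        also have "\<dots> = (\<Sum>u\<in>t. a ^ \<kappa> u * x * of_maxfield (r u) * of_maxfield l)"
          using x by (simp add: sum_distrib_right)
        also have "\<dots> = (\<Sum>u\<in>t. a ^ \<kappa> u * (x * of_maxfield l) * of_maxfield (r u))"
          by (simp add: mult.assoc comm)
        finally show "right_scale l x \<in> {x. b * x = (\<Sum>u\<in>t. a ^ \<kappa> u * x * of_maxfield (r u))}"
          by (simp add: right_scale_def)
      qed (simp_all add: algebra_simps sum.distrib)
      fix x assume "x \<in> ?P"
      then obtain k where k: "x = a ^ k * v" by blast
      have "b * a ^ k = a ^ k * b" using power_commuting_commutes[OF b[symmetric], of k] by simp
      then have "b * x = a ^ k * (b * v)" by (simp add: k mult.assoc[symmetric])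
      also have "\<dots> = (\<Sum>u\<in>t. a ^ k * (u * of_maxfield (r u)))"
        by (simp add: t(3) right_scale_def sum_distrib_left)
      also have "\<dots> = (\<Sum>u\<in>t. a ^ \<kappa> u * x * of_maxfield (r u))"
      proof (rule sum.cong[OF refl])
        fix u assume u: "u \<in> t"
        have "a ^ k * u = a ^ k * (a ^ \<kappa> u * v)" using \<kappa>[OF u] by simp
        also have "\<dots> = a ^ \<kappa> u * x"
          by (simp add: k mult.assoc[symmetric] power_add[symmetric] add.commute)
        finally show "a ^ k * (u * of_maxfield (r u)) = a ^ \<kappa> u * x * of_maxfield (r u)"
          by (simp add: mult.assoc[symmetric])
      qed
      finally show "b * x = (\<Sum>u\<in>t. a ^ \<kappa> u * x * of_maxfield (r u))" .
    qed
    then have eq: "b * x = (\<Sum>u\<in>t. a ^ \<kappa> u * x * of_maxfield (r u))" for x using span by simp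
    have inj: "inj_on (\<lambda>u. a ^ \<kappa> u) t" by (rule inj_onI) (metis \<kappa>)
    let ?A = "(\<lambda>u. a ^ \<kappa> u) ` t"
    have "b * x = (\<Sum>y\<in>?A. y * x * of_maxfield (r (y * v)))" for x
      unfolding sum.reindex[OF inj] eq o_def by (rule sum.cong) (use \<kappa> in auto)
    then have "b \<in> D.span ?A" by (rule two_sided_dependence[rotated]) (use t(1) in simp)
    moreover have "D.span ?A \<subseteq> ?K"
    proof (rule D.span_minimal)
      show "?A \<subseteq> ?K" using Kpow by blast
      show "D.subspace ?K"
        by (rule D.subspaceI) (use K0 Kadd Kmult Kz in \<open>auto simp: center_scale_def\<close>)
    qed
    ultimately show ?thesis by blast
  qed
  moreover have "b * a = a * b" if "comm_subfield M" "?K \<subset> M" "b \<in> M" for b M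
    using that sub unfolding comm_subfield_def by blast
  ultimately have "\<not> (\<exists>M. comm_subfield M \<and> ?K \<subset> M)" by blast
  then show ?thesis using K by (simp add: maximal_comm_subfield_def)
qed

section \<open>A cyclic value and the theorem\<close>

text \<open>An invariant subspace containing a combination of eigenvectors with distinct eigenvalues contains
  the eigenvectors that occur: \<open>T - \<mu> j\<close> removes one of them and rescales the others.\<close>

lemma (in vector_space) eigenvectors_in_invariant_subspace:
  assumes "finite I" and S: "subspace S" "\<And>x. x \<in> S \<Longrightarrow> T x \<in> S" and T: "linear_map scale T"
    and "\<And>b. b \<in> I \<Longrightarrow> T b = scale (\<mu> b) b" and "inj_on \<mu> I"
    and "(\<Sum>b\<in>I. scale (c b) b) \<in> S" and "b \<in> I" and "c b \<noteq> 0"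
  shows "b \<in> S"
  using assms(1,5-)
proof (induction I arbitrary: c b rule: finite_induct)
  case (insert j I)
  have eig: "T (\<Sum>b\<in>I. scale (c b) b) = (\<Sum>b\<in>I. scale (c b * \<mu> b) b)"
    unfolding linear_mapD(5)[OF T] using insert.prems(1)
    by (intro sum.cong) (auto simp: linear_mapD[OF T])
  let ?u = "scale (c j) j + (\<Sum>b\<in>I. scale (c b) b)"
  have u: "?u \<in> S" using insert.prems(3) insert.hyps by simp
  then have "T ?u - scale (\<mu> j) ?u \<in> S" using S by (simp add: subspace_diff subspace_scale)
  moreover have "T ?u - scale (\<mu> j) ?u = (\<Sum>b\<in>I. scale (c b * (\<mu> b - \<mu> j)) b)"
    using insert.prems(1)[of j]
    by (simp add: linear_mapD(1,2)[OF T] eig scale_right_distrib scale_sum_right right_diff_distrib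
        scale_left_diff_distrib sum_subtractf mult.commute)
  ultimately have comb: "(\<Sum>b\<in>I. scale (c b * (\<mu> b - \<mu> j)) b) \<in> S" by simp
  have I: "b \<in> S" if "b \<in> I" "c b \<noteq> 0" for b
  proof (rule insert.IH[OF _ _ comb that(1)])
    show "inj_on \<mu> I" using insert.prems(2) by simp
    have "\<mu> b \<noteq> \<mu> j" using insert.prems(2) insert.hyps(2) that(1) by (auto simp: inj_on_def)
    then show "c b * (\<mu> b - \<mu> j) \<noteq> 0" using that(2) by simp
  qed (use insert.prems(1) in simp)
  show ?case
  proof (cases "b = j")
    case True
    have "(\<Sum>b\<in>I. scale (c b) b) \<in> S"
      by (rule subspace_sum[OF S(1)]) (metis I S(1) scale_zero_left subspace_0 subspace_scale)
    then have "?u - (\<Sum>b\<in>I. scale (c b) b) \<in> S" using u S(1) by (simp only: subspace_diff)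
    then have "scale (c j) j \<in> S" by simp
    then have "scale (inverse (c j)) (scale (c j) j) \<in> S" by (rule subspace_scale[OF S(1)])
    then show ?thesis using True insert.prems(5) by simp
  qed (use I insert.prems(4,5) in auto)
qed simp

lemma ex_distinct_squares:
  fixes E :: "'e set"
  assumes "infinite (UNIV :: 'f :: field set)" and "finite E"
  shows "\<exists>\<delta> :: 'e \<Rightarrow> 'f. (\<forall>e. \<delta> e \<noteq> 0) \<and> inj_on (\<lambda>e. \<delta> e * \<delta> e) E"
  using assms(2)
proof (induction E rule: finite_induct)
  case empty
  show ?case by (rule exI[of _ "\<lambda>_. 1"]) simp
next
  case (insert e E)
  then obtain \<delta> :: "'e \<Rightarrow> 'f" where \<delta>: "\<forall>e. \<delta> e \<noteq> 0" "inj_on (\<lambda>e. \<delta> e * \<delta> e) E" by blast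
  have "finite ({0} \<union> \<delta> ` E \<union> uminus ` \<delta> ` E)" using insert.hyps(1) by simp
  from ex_new_if_finite[OF assms(1) this]
  obtain z where z: "z \<noteq> 0" "z \<notin> \<delta> ` E" "z \<notin> uminus ` \<delta> ` E" by auto
  let ?\<delta> = "\<delta>(e := z)"
  have "z * z \<noteq> \<delta> e' * \<delta> e'" if "e' \<in> E" for e'
    using z that unfolding square_eq_iff by blast
  then have "z * z \<notin> (\<lambda>e. \<delta> e * \<delta> e) ` E" by blast
  moreover have "?\<delta> e' = \<delta> e'" if "e' \<in> E" for e' using that insert.hyps(2) by auto
  ultimately have "inj_on (\<lambda>e. ?\<delta> e * ?\<delta> e) (insert e E)"
    using \<delta>(2) insert.hyps(2) by (simp add: inj_on_insert cong: inj_on_cong image_cong_simp)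
  then show ?case using \<delta>(1) z(1) by (intro exI[of _ ?\<delta>]) auto
qed

text \<open>A basis of \<open>D\<close> is split into pairs \<open>e\<close>, \<open>\<tau> e\<close> and at most one remaining vector. On the plane of
  each pair the arguments act by the two by two matrices \<open>A i\<close>, the first one scaled by \<open>\<delta> e\<close>, and
  they kill the remaining vector. The square of the value is then diagonal with
  eigenvalue \<open>(\<delta> e)\<^sup>2 p q\<close> on that plane and \<open>0\<close> on the remaining vector. These being distinct, the
  sum of the \<open>e\<close> and the remaining vector is cyclic: its span under the value contains each of
  them, and with \<open>e\<close> also \<open>\<tau> e\<close>.\<close>

lemma ex_cyclic_operator_value:
  fixes f :: "'a :: division_ring center ncpoly"
  assumes f: "multilinear_words n f" and nc: "noncentral_over_M2 f" and inf: "infinite (UNIV :: 'a center set)"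
    and fin: "finite C" "R.span C = (UNIV :: 'a set)"
  shows "\<exists>T v. (\<forall>i. T i \<in> bimult chosen_subfield) \<and>
    cyclic_vector right_scale (op_value center_scale f T) v"
proof -
  obtain A p q where n: "1 \<le> n" and pq: "p \<noteq> 0" "q \<noteq> 0" and A: "M2_value f A = mat2 0 p q 0"
    using noncentral_generic_value[OF f nc inf] by blast
  obtain B :: "'a set" where B: "R.independent B" "UNIV \<subseteq> R.span B"
    using R.maximal_independent_subset[of UNIV] by blast
  have finB: "finite B" using R.independent_span_bound[OF fin(1) B(1)] fin(2) by auto
  obtain E where E: "E \<subseteq> B" "card E = card B div 2" "finite E"
    using obtain_subset_with_card_n[of "card B div 2" B] by auto
  have card_BE: "card (B - E) = card B - card B div 2" using E by (simp add: card_Diff_subset)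
  then have "card B div 2 \<le> card (B - E)" by linarith
  then obtain O' where O: "O' \<subseteq> B - E" "card O' = card B div 2" "finite O'"
    by (rule obtain_subset_with_card_n)
  define Z where "Z = B - E - O'"
  have "card Z \<le> 1" using E O card_BE by (simp add: Z_def card_Diff_subset)
  have finZ: "finite Z" using finB by (simp add: Z_def)
  obtain \<tau> where \<tau>: "bij_betw \<tau> E O'" using finite_same_card_bij[OF E(3) O(3)] E(2) O(2) by auto
  obtain \<delta> :: "'a \<Rightarrow> 'a center" where \<delta>: "\<And>e. \<delta> e \<noteq> 0" "inj_on (\<lambda>e. \<delta> e * \<delta> e) E"
    using ex_distinct_squares[OF inf E(3)] by blast
  define M where "M e = A(1 := mat (\<delta> e) ** A 1)" for e
  have M: "M2_value f (M e) = mat2 0 (\<delta> e * p) (\<delta> e * q) 0" for e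
  proof -
    have "M2_value f (M e) = mat (\<delta> e) ** M2_value f (A(1 := A 1))"
      unfolding M_def by (rule M2_value_scale[OF f]) (use n in simp)
    then show ?thesis by (simp add: A mat2_eq_iff matrix_mult_2)
  qed
  define \<iota> where "\<iota> e y = e * of_center (y $ 1) + \<tau> e * of_center (y $ 2)" for e and y :: "'a center ^ 2"
  \<comment> \<open>the columns of \<open>M e i\<close> on the basis vectors \<open>e\<close> and \<open>\<tau> e\<close>\<close>
  define val where "val i b =
      (if b \<in> E then b * of_center (M b i $ 1 $ 1) + \<tau> b * of_center (M b i $ 2 $ 1)
       else if b \<in> O' then let e = inv_into E \<tau> b in
         e * of_center (M e i $ 1 $ 2) + b * of_center (M e i $ 2 $ 2)
       else 0)" for i b
  have "\<exists>\<phi>\<in>bimult chosen_subfield. \<forall>b\<in>B. \<phi> b = val i b" for i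
    by (rule interpolation[OF centralizer_chosen_subfield finB right_independentI[OF B(1)]])
  then obtain T where T: "\<And>i. T i \<in> bimult chosen_subfield" and val: "\<And>i b. b \<in> B \<Longrightarrow> T i b = val i b"
    by metis
  note lin = bimult_linear_map[OF T]
  have Tc: "T i (x * of_center z) = T i x * of_center z" for i x z
    using bimult_linear[OF centralizer_chosen_subfield _ T] by (simp add: chosen_subfield_closed)
  have Te: "T i e = e * of_center (M e i $ 1 $ 1) + \<tau> e * of_center (M e i $ 2 $ 1)" if "e \<in> E" for i e
    using val[of e i] that E(1) by (auto simp: val_def)
  have T\<tau>: "T i (\<tau> e) = e * of_center (M e i $ 1 $ 2) + \<tau> e * of_center (M e i $ 2 $ 2)" if "e \<in> E" for i e
  proof -
    have "\<tau> e \<in> O'" using \<tau> that by (auto simp: bij_betw_def)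
    moreover have "inv_into E \<tau> (\<tau> e) = e" using \<tau> that by (simp add: bij_betw_def)
    ultimately show ?thesis using val[of "\<tau> e" i] O(1) by (auto simp: val_def Let_def)
  qed
  have T\<iota>: "T i (\<iota> e y) = \<iota> e (M e i *v y)" if "e \<in> E" for i e y
  proof -
    have "T i (\<iota> e y) = T i e * of_center (y $ 1) + T i (\<tau> e) * of_center (y $ 2)"
      by (simp add: \<iota>_def R.linear_mapD[OF lin] Tc)
    also have "\<dots> = \<iota> e (M e i *v y)"
      unfolding Te[OF that] T\<tau>[OF that] \<iota>_def matrix_vector_mult_def
      by (simp add: sum_2 distrib_left distrib_right plus_center.rep_eq times_center.rep_eq mult.assoc
          add.assoc add.left_commute add.commute)
    finally show ?thesis .
  qed
  define T0 where "T0 = op_value center_scale f T"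
  have lin0: "linear_map right_scale T0" unfolding T0_def by (rule op_value_linear_map[OF lin])
  have T0\<iota>: "T0 (\<iota> e y) = \<iota> e (mat2 0 (\<delta> e * p) (\<delta> e * q) 0 *v y)" if "e \<in> E" for e y
  proof -
    have "\<iota> e (op_value (*s) f (\<lambda>i. (*v) (M e i)) y) = op_value center_scale f T (\<iota> e y)"
    proof (rule op_value_intertwine)
      show "\<iota> e (c *s x) = center_scale c (\<iota> e x)" for c x
      proof -
        have "center_scale c (\<iota> e x) = \<iota> e x * of_center c"
          unfolding center_scale_def by (rule of_center_commute)
        also have "\<dots> = e * of_center (x $ 1 * c) + \<tau> e * of_center (x $ 2 * c)"
          by (simp add: \<iota>_def distrib_right times_center.rep_eq mult.assoc)
        finally show ?thesis by (simp add: \<iota>_def mult.commute)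
      qed
      show "\<iota> e (M e i *v x) = T i (\<iota> e x)" for i x by (simp add: T\<iota>[OF that])
    qed (simp_all add: \<iota>_def zero_center.rep_eq plus_center.rep_eq distrib_left
        add.assoc add.left_commute add.commute)
    then show ?thesis by (simp add: T0_def M2_value_mult[symmetric] M)
  qed
  have T0e: "T0 e = right_scale (maxfield_of_center (\<delta> e * q)) (\<tau> e)" if "e \<in> E" for e
    using T0\<iota>[OF that, of "axis 1 1"]
    by (simp add: \<iota>_def matrix_vector_mult_def sum_2 axis_def zero_center.rep_eq one_center.rep_eq right_scale_def)
  have T0\<tau>: "T0 (\<tau> e) = right_scale (maxfield_of_center (\<delta> e * p)) e" if "e \<in> E" for e
    using T0\<iota>[OF that, of "axis 2 1"]
    by (simp add: \<iota>_def matrix_vector_mult_def sum_2 axis_def zero_center.rep_eq one_center.rep_eq right_scale_def)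
  have T0z: "T0 z = 0" if z: "z \<in> Z" for z
  proof -
    have Tz: "T i z = 0" for i using val[of z i] z by (simp add: val_def Z_def)
    have word: "foldr T w z = 0" if "w \<noteq> []" for w using that
      by (induction w rule: list_nonempty_induct) (simp_all add: Tz R.linear_mapD[OF lin])
    have "foldr T w z = 0" if "w \<in> Poly_Mapping.keys f" for w
    proof (rule word)
      have "set w = {1..n}" using f that by (simp add: multilinear_words_def)
      then show "w \<noteq> []" using n by auto
    qed
    then show ?thesis by (simp add: T0_def op_value_def)
  qed
  define \<mu> where "\<mu> b = (if b \<in> E then maxfield_of_center (\<delta> b * \<delta> b * (p * q)) else 0)" for b
  have sq: "T0 (T0 b) = right_scale (\<mu> b) b" if "b \<in> E \<union> Z" for b
  proof (cases "b \<in> E")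
    case True
    then have "T0 (T0 b) = right_scale (maxfield_of_center (\<delta> b * q)) (right_scale (maxfield_of_center (\<delta> b * p)) b)"
      by (simp add: T0e T0\<tau> R.linear_mapD[OF lin0])
    moreover have "maxfield_of_center (\<delta> b * q) * maxfield_of_center (\<delta> b * p)
        = maxfield_of_center ((\<delta> b * q) * (\<delta> b * p))"
      by (simp only: of_maxfield_inject[symmetric] of_maxfield_hom of_maxfield_of_center times_center.rep_eq)
    moreover have "(\<delta> b * q) * (\<delta> b * p) = \<delta> b * \<delta> b * (p * q)" by (simp add: ac_simps)
    ultimately show ?thesis using True by (simp only: \<mu>_def R.scale_scale if_True)
  next
    case False
    then show ?thesis using that by (simp add: \<mu>_def T0z R.linear_mapD[OF lin0])
  qed
  have mz: "maxfield_of_center z \<noteq> 0" if "z \<noteq> 0" for z :: "'a center"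
  proof
    assume "maxfield_of_center z = 0"
    then have "of_center z = 0" by (metis of_maxfield_of_center zero_maxfield.rep_eq)
    then show False using that by (metis of_center_inject zero_center.rep_eq)
  qed
  have Z1: "x = y" if "x \<in> Z" "y \<in> Z" for x y
    using card_le_Suc0_iff_eq[OF finZ] \<open>card Z \<le> 1\<close> that by simp
  have inj: "inj_on \<mu> (E \<union> Z)"
  proof (rule inj_onI)
    fix x y assume xy: "x \<in> E \<union> Z" "y \<in> E \<union> Z" and eq: "\<mu> x = \<mu> y"
    have "x \<in> E \<longleftrightarrow> y \<in> E"
      using eq mz[of "\<delta> x * \<delta> x * (p * q)"] mz[of "\<delta> y * \<delta> y * (p * q)"] \<delta>(1) pq
      by (auto simp: \<mu>_def split: if_splits)
    moreover have "x = y" if "x \<in> E" "y \<in> E"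
    proof (rule inj_onD[OF \<delta>(2) _ that])
      show "\<delta> x * \<delta> x = \<delta> y * \<delta> y"
        using eq that pq by (simp add: \<mu>_def maxfield_of_center_inject)
    qed
    ultimately show "x = y" using xy Z1 by blast
  qed
  define v where "v = (\<Sum>b\<in>E \<union> Z. b)"
  let ?S = "R.span (range (\<lambda>k. (T0 ^^ k) v))"
  have inv: "T0 x \<in> ?S" if "x \<in> ?S" for x
  proof (rule R.span_induct[OF that])
    show "R.subspace {x. T0 x \<in> ?S}"
      by (rule R.subspaceI) (simp_all add: R.linear_mapD[OF lin0] R.span_zero R.span_add R.span_scale)
    fix y assume "y \<in> range (\<lambda>k. (T0 ^^ k) v)"
    then obtain k where "y = (T0 ^^ k) v" by blast
    then have "T0 y = (T0 ^^ Suc k) v" by simp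
    then show "T0 y \<in> ?S" by (metis R.span_base rangeI)
  qed
  have EZ: "b \<in> ?S" if "b \<in> E \<union> Z" for b
  proof (rule R.eigenvectors_in_invariant_subspace[where T = "\<lambda>x. T0 (T0 x)" and \<mu> = \<mu> and c = "\<lambda>_. 1"])
    show "finite (E \<union> Z)" using E(3) finZ by simp
    show "linear_map right_scale (\<lambda>x. T0 (T0 x))"
      by (simp add: linear_map_def R.linear_mapD[OF lin0])
    have "(T0 ^^ 0) v \<in> ?S" by (rule R.span_base) blast
    then show "(\<Sum>b\<in>E \<union> Z. right_scale 1 b) \<in> ?S" by (simp add: v_def)
  qed (use that inv sq inj in auto)
  have "\<tau> e \<in> ?S" if "e \<in> E" for e
  proof -
    have "right_scale (maxfield_of_center (\<delta> e * q)) (\<tau> e) \<in> ?S"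
      using inv[OF EZ[of e]] that by (simp add: T0e)
    then have "right_scale (inverse (maxfield_of_center (\<delta> e * q))) (right_scale (maxfield_of_center (\<delta> e * q)) (\<tau> e)) \<in> ?S"
      by (rule R.span_scale)
    then show ?thesis using mz[of "\<delta> e * q"] \<delta>(1) pq by simp
  qed
  then have "O' \<subseteq> ?S" using \<tau> by (auto simp: bij_betw_def)
  then have "B \<subseteq> ?S" using EZ unfolding Z_def by blast
  then have "?S = UNIV" using R.span_mono[of B ?S] B(2) R.span_span by blast
  then have "cyclic_vector right_scale T0 v" by (simp add: cyclic_vector_def)
  then show ?thesis using T unfolding T0_def by blast
qed

theorem theorem4p2:
  fixes f :: "('a :: division_ring) center ncpoly" and n :: nat
  assumes "\<exists>B :: 'a set. finite B \<and> module.span center_scale B = UNIV"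
    and "multilinear_ncpoly n f"
    and "noncentral_over_M2 f"
  shows "\<exists>c :: nat \<Rightarrow> 'a. maximal_comm_subfield (center_adjoin (division_ring_value f c))"
proof (cases "\<forall>x y :: 'a. x * y = y * x")
  case True
  have "x \<in> range of_center" for x :: 'a
    using centralizer_UNIV[of x] True by (simp add: centralizer_def)
  then have "center_adjoin a = UNIV" for a :: 'a
    unfolding center_adjoin_def using hull_subset[of "insert a (range of_center)" comm_subfield] by blast
  then have "maximal_comm_subfield (center_adjoin a)" for a :: 'a
    using comm_subfield_center_adjoin[of a] by (simp add: maximal_comm_subfield_def)
  then show ?thesis by blast
next
  case False
  obtain C :: "'a set" where C: "finite C" "D.span C = UNIV" using assms(1) by blast
  have inf: "infinite (UNIV :: 'a center set)"
  proof
    assume "finite (UNIV :: 'a center set)"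
    then have "finite (C \<rightarrow>\<^sub>E (UNIV :: 'a center set))" using C(1) by (intro finite_PiE) auto
    moreover have "(UNIV :: 'a set) \<subseteq> (\<lambda>u. \<Sum>b\<in>C. center_scale (u b) b) ` (C \<rightarrow>\<^sub>E UNIV)"
    proof
      fix x :: 'a
      have "x \<in> range (\<lambda>u. \<Sum>b\<in>C. center_scale (u b) b)"
        using C(2) unfolding D.span_finite[OF C(1)] by simp
      then obtain u where "x = (\<Sum>b\<in>C. center_scale (u b) b)" by (rule imageE)
      then have "x = (\<Sum>b\<in>C. center_scale (restrict u C b) b)" by simp
      then show "x \<in> (\<lambda>u. \<Sum>b\<in>C. center_scale (u b) b) ` (C \<rightarrow>\<^sub>E UNIV)"
        by (intro image_eqI[of x _ "restrict u C"]) simp_all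
    qed
    ultimately have "finite (UNIV :: 'a set)" by (meson finite_imageI finite_subset)
    then show False using False finite_division_ring_commutative by blast
  qed
  have "x \<in> R.span C" for x :: 'a
  proof -
    have "x \<in> D.span C" using C(2) by simp
    then show ?thesis
    proof (rule D.span_induct)
      show "D.subspace {x. x \<in> R.span C}"
      proof (rule D.subspaceI)
        fix z and x :: 'a assume "x \<in> {x. x \<in> R.span C}"
        then have "right_scale (maxfield_of_center z) x \<in> R.span C" by (simp add: R.span_scale)
        then show "center_scale z x \<in> {x. x \<in> R.span C}"
          by (simp add: right_scale_def center_scale_def of_center_commute)
      qed (simp_all add: R.span_zero R.span_add)
    qed (rule R.span_base)
  qed
  then have span: "R.span C = UNIV" by blast
  have f: "multilinear_words n f" by (rule multilinear_imp_words[OF assms(2)])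
  obtain T v where T: "\<And>i. T i \<in> bimult chosen_subfield"
    and cyc: "cyclic_vector right_scale (op_value center_scale f T) v"
    using ex_cyclic_operator_value[OF f assms(3) inf C(1) span] by blast
  obtain c where "cyclic_vector right_scale (\<lambda>x. division_ring_value f c * x) v"
    using replace_operators[OF f inf C(1) span T cyc] by blast
  then show ?thesis using cyclic_vector_imp_maximal by blast
qed

end
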